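(* Let $k \geq 1$. Then $$\sqrt{\frac{n}{k}} < T^{\downarrow}(n,k) \leq \left\lceil\frac{n}{k}\right\rceil.$$
   Context: Here $n$ (the matrix size) and $k$ are positive integers. An operator system in $M_n(\mathbb{C})$ is a complex linear subspace $\mathcal{V} \subseteq M_n(\mathbb{C})$ containing the identity matrix $I_n$ and such that $A \in \mathcal{V}$ implies $A^* \in \mathcal{V}$, where $A^*$ is the Hermitian (conjugate) transpose. An orthogonal projection is a matrix $P \in M_n(\mathbb{C})$ with $P = P^2 = P^*$, and $P\mathcal{V}P = \{PAP : A \in \mathcal{V}\}$. For an integer $m \geq 1$, a quantum $m$-anticlique for $\mathcal{V}$ is a rank $m$ orthogonal projection $P \in M_n(\mathbb{C})$ with $\dim(P\mathcal{V}P) = 1$ (equivalently, $PAP$ is a scalar multiple of $P$ for every $A \in \mathcal{V}$). Dimensions are over $\mathbb{C}$. The lower quantum Turán number $T^{\downarrow}(n,k)$ is the smallest number $d$ such that some operator system in $M_n(\mathbb{C})$ whose dimension is $d$ has no quantum $(k+1)$-anticliques.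
   Formalization: The strict lower bound is stated only for n ≠ k, because for n = k no projection has rank k+1, so the lower quantum Turán number is 1 = √(n/k) and the strict inequality fails; the upper bound is stated for all n, k ≥ 1. *)

theory Defs
  imports
    Complex_Main
    "Jordan_Normal_Form.DL_Rank"
    "Jordan_Normal_Form.Schur_Decomposition"
begin

definition mat_space_dim :: "nat \<Rightarrow> complex mat set \<Rightarrow> nat" where
  "mat_space_dim n W =
     vectorspace.dim (class_ring :: complex ring) ((module_mat TYPE(complex) n n)\<lparr>carrier := W\<rparr>)"

definition operator_system :: "nat \<Rightarrow> complex mat set \<Rightarrow> bool" where
  "operator_system n V \<longleftrightarrow>
     VectorSpace.subspace (class_ring :: complex ring) V (module_mat TYPE(complex) n n) \<and>
     1\<^sub>m n \<in> V \<and>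
     (\<forall>A\<in>V. mat_adjoint A \<in> V)"

definition orthogonal_projection :: "nat \<Rightarrow> complex mat \<Rightarrow> bool" where
  "orthogonal_projection n P \<longleftrightarrow> P \<in> carrier_mat n n \<and> P * P = P \<and> mat_adjoint P = P"

definition compression :: "complex mat \<Rightarrow> complex mat set \<Rightarrow> complex mat set" where
  "compression P V = {P * A * P | A. A \<in> V}"

definition quantum_anticlique :: "nat \<Rightarrow> nat \<Rightarrow> complex mat set \<Rightarrow> complex mat \<Rightarrow> bool" where
  "quantum_anticlique n m V P \<longleftrightarrow>
     orthogonal_projection n P \<and>
     vec_space.rank n P = m \<and>
     mat_space_dim n (compression P V) = 1"

(* If m > n, there is no rank m projection, hence no quantum m-anticlique.  In particular, for
   n \<le> k the scalar matrices witness lower_quantum_turan n k = 1,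
   so that lower_quantum_turan n n = 1 = sqrt (n / n). *)
definition lower_quantum_turan :: "nat \<Rightarrow> nat \<Rightarrow> nat" where
  "lower_quantum_turan n k =
     (LEAST d. \<exists>V. operator_system n V \<and> mat_space_dim n V = d \<and>
                   (\<nexists>P. quantum_anticlique n (k + 1) V P))"

end

theory Submission
  imports
    Defs
    "HOL-Analysis.Function_Topology"
    "Jordan_Normal_Form.Spectral_Radius"
begin

text \<open>
  Upper bound: cut the standard basis into \<open>\<lceil>n/k\<rceil>\<close> blocks of at most \<open>k\<close> vectors and take the span of the
  coordinate projections \<open>E\<^sub>b\<close> onto the blocks. For an anticlique \<open>P\<close> of rank \<open>k + 1\<close> the matrix
  \<open>P E\<^sub>b P\<close> is a multiple of \<open>P\<close> of rank at most \<open>k\<close>, hence zero, and summing over \<open>b\<close> gives \<open>P = 0\<close>.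

  Lower bound: let \<open>V\<close> have dimension \<open>d\<close> with \<open>k d\<^sup>2 \<le> n\<close>. Choosing vectors greedily, the first one an
  eigenvector of a suitable member of \<open>V\<close>, produces nonzero \<open>e\<^sub>0, \<dots>, e\<^sub>k\<^sub>d\<close> with
  \<open>\<langle>e\<^sub>s, A e\<^sub>t\<rangle> = 0\<close> for all \<open>A\<close> in \<open>V\<close> and \<open>s \<noteq> t\<close>. In a Hermitian basis of \<open>V\<close> the diagonal values
  \<open>\<langle>e\<^sub>s, A e\<^sub>s\<rangle>\<close> form \<open>k d + 1\<close> vectors of \<open>\<real>\<^sup>d\<close>. Tverberg's theorem splits these into \<open>k + 1\<close> parts with equal
  weighted sums, and superposing the \<open>e\<^sub>s\<close> of each part with the square roots of the weights as
  coefficients yields \<open>k + 1\<close> orthogonal vectors spanning the range of an anticlique.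
\<close>

section \<open>Conical Tverberg theorem\<close>

text \<open>Gaussian elimination, one equation at a time: an equation with a nonzero coefficient is
  solved for one unknown, which is then eliminated from the others. The index types are arbitrary
  because the equations are later indexed by pairs, over the reals for the weights and over the
  complex numbers for orthogonality.\<close>

lemma underdetermined_system_nontrivial_solution:
  fixes a :: "'j \<Rightarrow> 'i \<Rightarrow> 'a::field"
  assumes "finite J" "finite I" "card J < card I"
  obtains x where "\<exists>i\<in>I. x i \<noteq> 0" "\<And>j. j \<in> J \<Longrightarrow> (\<Sum>i\<in>I. a j i * x i) = 0"
proof -
  have "\<exists>x. (\<exists>i\<in>I. x i \<noteq> 0) \<and> (\<forall>j\<in>J. (\<Sum>i\<in>I. a j i * x i) = 0)"
    using assms
  proof (induction J arbitrary: I a rule: finite_induct)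
    case empty
    then have "I \<noteq> {}" by auto
    then show ?case by (intro exI[of _ "\<lambda>_. 1"]) auto
  next
    case (insert j0 J)
    show ?case
    proof (cases "\<forall>i\<in>I. a j0 i = 0")
      case True
      from insert have "card J < card I" by simp
      from insert.IH[OF insert.prems(1) this, of a] obtain x where
        "\<exists>i\<in>I. x i \<noteq> 0" "\<forall>j\<in>J. (\<Sum>i\<in>I. a j i * x i) = 0" by blast
      with True show ?thesis by (intro exI[of _ x]) auto
    next
      case False
      then obtain i0 where i0: "i0 \<in> I" "a j0 i0 \<noteq> 0" by blast
      define I' where "I' = I - {i0}"
      have I': "finite I'" "i0 \<notin> I'" "I = insert i0 I'" using i0 insert.prems by (auto simp: I'_def)
      have "card J < card I'" using insert I' by auto
      \<comment> \<open>The coefficients left after subtracting the multiple of the pivot row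
        \<open>j0\<close> that clears column \<open>i0\<close>.\<close>
      from insert.IH[OF I'(1) this, of "\<lambda>j i. a j i - a j i0 * a j0 i / a j0 i0"] obtain x where
        x: "\<exists>i\<in>I'. x i \<noteq> 0" "\<forall>j\<in>J. (\<Sum>i\<in>I'. (a j i - a j i0 * a j0 i / a j0 i0) * x i) = 0" by blast
      define x' where "x' = x(i0 := - (\<Sum>i\<in>I'. a j0 i * x i) / a j0 i0)"
      have s: "(\<Sum>i\<in>I. a j i * x' i) =
          a j i0 * (- (\<Sum>i\<in>I'. a j0 i * x i) / a j0 i0) + (\<Sum>i\<in>I'. a j i * x i)" for j
      proof -
        have "(\<Sum>i\<in>I'. a j i * x' i) = (\<Sum>i\<in>I'. a j i * x i)"
          using I' by (intro sum.cong) (auto simp: x'_def)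
        then show ?thesis using I' by (simp add: x'_def)
      qed
      have "(\<Sum>i\<in>I. a j i * x' i) = 0" if "j \<in> J" for j
      proof -
        have "0 = (\<Sum>i\<in>I'. (a j i - a j i0 * a j0 i / a j0 i0) * x i)"
          using x(2) that by simp
        also have "\<dots> = (\<Sum>i\<in>I'. a j i * x i - a j i0 / a j0 i0 * (a j0 i * x i))"
          by (intro sum.cong) (simp_all add: algebra_simps)
        also have "\<dots> = (\<Sum>i\<in>I'. a j i * x i) - a j i0 / a j0 i0 * (\<Sum>i\<in>I'. a j0 i * x i)"
          by (simp add: sum_subtractf sum_distrib_left)
        finally show ?thesis unfolding s by simp
      qed
      moreover have "(\<Sum>i\<in>I. a j0 i * x' i) = 0" unfolding s using i0 by simp
      moreover have "\<exists>i\<in>I. x' i \<noteq> 0" using x(1) I' by (auto simp: x'_def)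
      ultimately show ?thesis by (intro exI[of _ x']) auto
    qed
  qed
  then show thesis using that by blast
qed

section \<open>The spread of the part sums and its minimisers\<close>

locale coloured_points =
  fixes x :: "nat \<Rightarrow> 'c \<Rightarrow> real" and C :: "'c set" and k N :: nat
  assumes finite_C: "finite C"
begin

definition part_sum :: "(nat \<Rightarrow> nat) \<Rightarrow> (nat \<Rightarrow> real) \<Rightarrow> nat \<Rightarrow> 'c \<Rightarrow> real" where
  "part_sum \<sigma> w j c = (\<Sum>i\<le>N. of_bool (\<sigma> i = j) * x i c * w i)"

text \<open>The distance of a part sum from the mean of all \<open>k + 1\<close> part sums, scaled
  by \<open>k + 1\<close> to avoid division.\<close>

definition deviation :: "(nat \<Rightarrow> nat) \<Rightarrow> (nat \<Rightarrow> real) \<Rightarrow> nat \<Rightarrow> 'c \<Rightarrow> real" where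
  "deviation \<sigma> w j c = real (k + 1) * part_sum \<sigma> w j c - (\<Sum>l\<le>k. part_sum \<sigma> w l c)"

text \<open>On the diagonal \<open>v = w\<close> this is the sum of the squared distances over all
  unordered pairs of part sums. It is set up as a bilinear form so that its values off the diagonal
  give directional derivatives in the weights.\<close>

definition spread :: "(nat \<Rightarrow> nat) \<Rightarrow> (nat \<Rightarrow> real) \<Rightarrow> (nat \<Rightarrow> real) \<Rightarrow> real" where
  "spread \<sigma> v w = (\<Sum>c\<in>C. \<Sum>j\<le>k. part_sum \<sigma> v j c * deviation \<sigma> w j c)"

text \<open>The standard simplex on \<open>N + 1\<close> points. Fixing the values beyond
  \<open>N\<close> makes it a compact subset of the function space.\<close>

definition weights :: "(nat \<Rightarrow> real) set" where
  "weights = {w. (\<forall>i\<le>N. 0 \<le> w i) \<and> (\<forall>i>N. w i = 0) \<and> (\<Sum>i\<le>N. w i) = 1}"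

lemma part_sum_lin: "part_sum \<sigma> (\<lambda>i. a * v i + b * w i) j c = a * part_sum \<sigma> v j c + b * part_sum \<sigma> w j c"
  by (simp add: part_sum_def sum.distrib sum_distrib_left algebra_simps)

lemma deviation_lin: "deviation \<sigma> (\<lambda>i. a * v i + b * w i) j c = a * deviation \<sigma> v j c + b * deviation \<sigma> w j c"
  by (simp add: deviation_def part_sum_lin sum.distrib sum_distrib_left[symmetric] algebra_simps)

lemma sum_deviation: "(\<Sum>j\<le>k. deviation \<sigma> w j c) = 0"
  by (simp add: deviation_def sum_subtractf sum_distrib_left[symmetric])

lemma spread_sym: "spread \<sigma> v w = spread \<sigma> w v"
  unfolding spread_def deviation_def
  by (rule sum.cong) (simp_all add: right_diff_distrib sum_subtractf sum_distrib_right[symmetric] algebra_simps)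

lemma spread_lin: "spread \<sigma> (\<lambda>i. a * v i + b * w i) u = a * spread \<sigma> v u + b * spread \<sigma> w u"
  by (simp add: spread_def part_sum_lin sum.distrib sum_distrib_left algebra_simps)

lemma spread_lin2: "spread \<sigma> u (\<lambda>i. a * v i + b * w i) = a * spread \<sigma> u v + b * spread \<sigma> u w"
  using spread_lin spread_sym by metis

text \<open>Deviations sum to zero over the parts, so the mean part sum contributes nothing when
  paired with them. The resulting sum of squares shows that the spread is nonnegative and vanishes
  only if all part sums agree.\<close>

lemma spread_self: "real (k + 1) * spread \<sigma> w w = (\<Sum>c\<in>C. \<Sum>j\<le>k. (deviation \<sigma> w j c)\<^sup>2)"
proof -
  have "(\<Sum>j\<le>k. (deviation \<sigma> w j c)\<^sup>2) = real (k + 1) * (\<Sum>j\<le>k. part_sum \<sigma> w j c * deviation \<sigma> w j c)" for c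
  proof -
    have "(\<Sum>j\<le>k. (deviation \<sigma> w j c)\<^sup>2) = (\<Sum>j\<le>k. real (k + 1) * (part_sum \<sigma> w j c * deviation \<sigma> w j c)
        - (\<Sum>l\<le>k. part_sum \<sigma> w l c) * deviation \<sigma> w j c)"
      by (rule sum.cong) (simp_all add: power2_eq_square, simp add: deviation_def algebra_simps)
    also have "\<dots> = real (k + 1) * (\<Sum>j\<le>k. part_sum \<sigma> w j c * deviation \<sigma> w j c)
        - (\<Sum>l\<le>k. part_sum \<sigma> w l c) * (\<Sum>j\<le>k. deviation \<sigma> w j c)"
      by (simp only: sum_subtractf sum_distrib_left)
    finally show ?thesis by (simp add: sum_deviation)
  qed
  then show ?thesis by (simp only: spread_def sum_distrib_left)
qed

lemma spread_nonneg: "0 \<le> spread \<sigma> w w"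
proof -
  have "0 \<le> real (k + 1) * spread \<sigma> w w" unfolding spread_self by (intro sum_nonneg) auto
  then show ?thesis by (simp add: zero_le_mult_iff)
qed

lemma spread_eq_0D:
  assumes "spread \<sigma> w w = 0" "j \<le> k" "c \<in> C"
  shows "deviation \<sigma> w j c = 0"
proof -
  have 0: "(\<Sum>c\<in>C. \<Sum>j\<le>k. (deviation \<sigma> w j c)\<^sup>2) = 0" using spread_self[of \<sigma> w] assms(1) by simp
  have "(\<Sum>j\<le>k. (deviation \<sigma> w j c)\<^sup>2) = 0"
    using 0 assms(3) finite_C by (subst (asm) sum_nonneg_eq_0_iff) (auto intro: sum_nonneg)
  then have "(deviation \<sigma> w j c)\<^sup>2 = 0"
    using assms(2) by (subst (asm) sum_nonneg_eq_0_iff) auto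
  then show ?thesis by simp
qed

lemma part_sum_single: "i \<le> N \<Longrightarrow> part_sum \<sigma> (\<lambda>l. of_bool (l = i)) j c = of_bool (\<sigma> i = j) * x i c"
  by (simp add: part_sum_def)

text \<open>Half the partial derivative of \<open>spread \<sigma> w w\<close> in the weight of the
  point \<open>i\<close>: only the part that contains \<open>i\<close> feels the change.\<close>

lemma spread_single:
  assumes "i \<le> N" "\<sigma> i \<le> k"
  shows "spread \<sigma> (\<lambda>l. of_bool (l = i)) w = (\<Sum>c\<in>C. x i c * deviation \<sigma> w (\<sigma> i) c)"
  unfolding spread_def part_sum_single[OF assms(1)]
proof (rule sum.cong[OF refl])
  fix c
  have "(\<Sum>j\<le>k. of_bool (\<sigma> i = j) * x i c * deviation \<sigma> w j c)
      = (\<Sum>j\<in>{..k}. if j = \<sigma> i then x i c * deviation \<sigma> w j c else 0)"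
    by (rule sum.cong) auto
  then show "(\<Sum>j\<le>k. of_bool (\<sigma> i = j) * x i c * deviation \<sigma> w j c) = x i c * deviation \<sigma> w (\<sigma> i) c"
    using assms(2) by simp
qed

lemma spread_expand:
  assumes "\<forall>i\<le>N. \<sigma> i \<le> k"
  shows "spread \<sigma> v w = (\<Sum>i\<le>N. v i * spread \<sigma> (\<lambda>l. of_bool (l = i)) w)"
proof -
  have "spread \<sigma> v w = (\<Sum>c\<in>C. \<Sum>i\<le>N. v i * (x i c * deviation \<sigma> w (\<sigma> i) c))"
    unfolding spread_def
  proof (rule sum.cong[OF refl])
    fix c
    have "(\<Sum>j\<le>k. part_sum \<sigma> v j c * deviation \<sigma> w j c)
        = (\<Sum>i\<le>N. \<Sum>j\<le>k. of_bool (\<sigma> i = j) * x i c * v i * deviation \<sigma> w j c)"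
      unfolding part_sum_def sum_distrib_right by (rule sum.swap)
    also have "\<dots> = (\<Sum>i\<le>N. v i * (x i c * deviation \<sigma> w (\<sigma> i) c))"
    proof (rule sum.cong[OF refl])
      fix i assume i: "i \<in> {..N}"
      have "(\<Sum>j\<le>k. of_bool (\<sigma> i = j) * x i c * v i * deviation \<sigma> w j c)
        = (\<Sum>j\<in>{..k}. if j = \<sigma> i then v i * (x i c * deviation \<sigma> w j c) else 0)"
        by (rule sum.cong) auto
      then show "(\<Sum>j\<le>k. of_bool (\<sigma> i = j) * x i c * v i * deviation \<sigma> w j c)
        = v i * (x i c * deviation \<sigma> w (\<sigma> i) c)"
        using assms i by simp
    qed
    finally show "(\<Sum>j\<le>k. part_sum \<sigma> v j c * deviation \<sigma> w j c)
        = (\<Sum>i\<le>N. v i * (x i c * deviation \<sigma> w (\<sigma> i) c))" .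
  qed
  also have "\<dots> = (\<Sum>i\<le>N. v i * (\<Sum>c\<in>C. x i c * deviation \<sigma> w (\<sigma> i) c))"
    by (subst sum.swap) (simp add: sum_distrib_left)
  finally show ?thesis using assms by (simp add: spread_single)
qed

text \<open>Tychonoff's theorem: the simplex is a closed subset of a product of compact intervals,
  with degenerate factors beyond \<open>N\<close>.\<close>

lemma compact_weights: "compact weights"
proof -
  let ?B = "PiE UNIV (\<lambda>i. if i \<le> N then {0..1::real} else {0})"
  have "compactin (product_topology (\<lambda>i. euclidean) (UNIV::nat set)) ?B"
    by (subst compactin_PiE) (auto simp: compactin_euclidean_iff)
  then have "compact ?B" by (simp add: euclidean_product_topology compactin_euclidean_iff)
  moreover have cont: "continuous_on UNIV (\<lambda>w::nat \<Rightarrow> real. \<Sum>i\<le>N. w i)"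
    by (intro continuous_on_sum continuous_on_product_coordinates)
  have "closed {w::nat \<Rightarrow> real. (\<Sum>i\<le>N. w i) = 1}"
    by (rule closed_Collect_eq[OF cont]) (auto intro: continuous_on_const)
  moreover have "weights = ?B \<inter> {w. (\<Sum>i\<le>N. w i) = 1}"
  proof (intro equalityI subsetI)
    fix w assume w: "w \<in> weights"
    have "w i \<le> 1" if "i \<le> N" for i
    proof -
      have "w i \<le> (\<Sum>i\<le>N. w i)" using w that by (intro member_le_sum) (auto simp: weights_def)
      then show ?thesis using w by (simp add: weights_def)
    qed
    then show "w \<in> ?B \<inter> {w. (\<Sum>i\<le>N. w i) = 1}" using w by (auto simp: weights_def)
  next
    fix w assume "w \<in> ?B \<inter> {w. (\<Sum>i\<le>N. w i) = 1}"
    then have B: "\<And>i. w i \<in> (if i \<le> N then {0..1::real} else {0})" and s: "(\<Sum>i\<le>N. w i) = 1"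
      by (auto simp: PiE_iff)
    have "0 \<le> w i" if "i \<le> N" for i using B[of i] that by simp
    moreover have "w i = 0" if "i > N" for i using B[of i] that by simp
    ultimately show "w \<in> weights" using s by (auto simp: weights_def)
  qed
  ultimately show ?thesis using compact_Int_closed by metis
qed

lemma continuous_spread: "continuous_on UNIV (\<lambda>w. spread \<sigma> w w)"
proof -
  have p: "continuous_on UNIV (\<lambda>w. part_sum \<sigma> w j c)" for j c
    unfolding part_sum_def
    by (intro continuous_on_sum continuous_on_mult continuous_on_const continuous_on_product_coordinates)
  show ?thesis unfolding spread_def deviation_def
    by (intro continuous_on_sum continuous_on_mult continuous_on_diff continuous_on_const p)
qed

text \<open>Compactness gives optimal weights for each colouring, and only finitely many colourings
  of the points up to \<open>N\<close> have to be compared.\<close>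

lemma exists_minimiser:
  obtains \<sigma> w where "\<forall>i\<le>N. \<sigma> i \<le> k" "w \<in> weights"
    "\<And>\<tau> v. \<forall>i\<le>N. \<tau> i \<le> k \<Longrightarrow> v \<in> weights \<Longrightarrow> spread \<sigma> w w \<le> spread \<tau> v v"
proof -
  have "(\<lambda>l. of_bool (l = 0)) \<in> weights" by (auto simp: weights_def)
  then have "\<exists>w\<in>weights. \<forall>v\<in>weights. spread \<sigma> w w \<le> spread \<sigma> v v" for \<sigma>
    using continuous_attains_inf[OF compact_weights, of "\<lambda>w. spread \<sigma> w w"]
      continuous_on_subset[OF continuous_spread] by blast
  then obtain W where W: "\<And>\<sigma>. W \<sigma> \<in> weights" "\<And>\<sigma> v. v \<in> weights \<Longrightarrow> spread \<sigma> (W \<sigma>) (W \<sigma>) \<le> spread \<sigma> v v"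
    by metis
  let ?P = "PiE {..N} (\<lambda>_. {..k})"
  have fin: "finite ?P" by (simp add: finite_PiE)
  have ne: "?P \<noteq> {}" by (auto simp: PiE_eq_empty_iff)
  obtain \<sigma> where \<sigma>: "\<sigma> \<in> ?P" "\<And>\<tau>. \<tau> \<in> ?P \<Longrightarrow> spread \<sigma> (W \<sigma>) (W \<sigma>) \<le> spread \<tau> (W \<tau>) (W \<tau>)"
    using ex_is_arg_min_if_finite[OF fin ne, of "\<lambda>\<sigma>. spread \<sigma> (W \<sigma>) (W \<sigma>)"]
    by (auto simp: is_arg_min_linorder)
  show thesis
  proof
    show "\<forall>i\<le>N. \<sigma> i \<le> k" using \<sigma>(1) by auto
    show "W \<sigma> \<in> weights" by (rule W)
    fix \<tau> v assume \<tau>: "\<forall>i\<le>N. \<tau> i \<le> k" and v: "v \<in> weights"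
    \<comment> \<open>Restriction places an arbitrary colouring in the finite set \<open>?P\<close>;
      the spread does not see colours beyond \<open>N\<close>.\<close>
    let ?t = "restrict \<tau> {..N}"
    have "?t \<in> ?P" using \<tau> by auto
    then have "spread \<sigma> (W \<sigma>) (W \<sigma>) \<le> spread ?t (W ?t) (W ?t)" by (rule \<sigma>)
    also have "\<dots> \<le> spread ?t v v" by (rule W(2)[OF v])
    also have "part_sum ?t v = part_sum \<tau> v" by (auto simp: part_sum_def fun_eq_iff)
    then have "spread ?t v v = spread \<tau> v v" by (simp add: spread_def deviation_def)
    finally show "spread \<sigma> (W \<sigma>) (W \<sigma>) \<le> spread \<tau> v v" .
  qed
qed

text \<open>The segment from \<open>w\<close> to the vertex \<open>i\<close> stays in the simplex.
  The derivative of the spread at its start is twice the difference of the two sides and cannot be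
  negative at a minimum.\<close>

lemma minimiser_first_order:
  assumes w: "w \<in> weights" and i: "i \<le> N"
    and min: "\<And>v. v \<in> weights \<Longrightarrow> spread \<sigma> w w \<le> spread \<sigma> v v"
  shows "spread \<sigma> w w \<le> spread \<sigma> (\<lambda>l. of_bool (l = i)) w"
proof (rule ccontr)
  define F where "F = spread \<sigma> w w"
  define e where "e = (\<lambda>l. of_bool (l = i) :: real)"
  define G where "G = spread \<sigma> e w"
  define K where "K = spread \<sigma> e e"
  assume "\<not> ?thesis"
  then have FG: "G < F" by (simp add: F_def G_def e_def)
  have K0: "K \<ge> 0" by (simp add: K_def spread_nonneg)
  have F0: "F \<ge> 0" by (simp add: F_def spread_nonneg)
  have *: "F \<le> (1-t)\<^sup>2 * F + 2 * t * (1-t) * G + t\<^sup>2 * K" if t: "0 \<le> t" "t \<le> 1" for t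
  proof -
    have "(\<Sum>l\<le>N. (1-t) * w l + t * e l) = 1"
      using w i by (simp add: weights_def sum.distrib sum_distrib_left[symmetric] e_def)
    then have "(\<lambda>l. (1-t) * w l + t * e l) \<in> weights"
      using w i t by (auto simp: weights_def e_def)
    from min[OF this] show ?thesis
      unfolding spread_lin spread_lin2 F_def[symmetric] K_def[symmetric] spread_sym[of \<sigma> w e] G_def[symmetric]
      by (simp add: algebra_simps power2_eq_square)
  qed
  \<comment> \<open>A step so short that the quadratic term
    \<open>t\<^sup>2 * (F - 2 * G + K)\<close> is at most \<open>t * (F - G)\<close> and cannot make
    up for the linear loss \<open>2 * t * (F - G)\<close>. The denominator dominates both
    \<open>F - 2 * G + K\<close> and \<open>F - G\<close>; the latter gives
    \<open>t \<le> 1\<close>.\<close>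
  define t where "t = (F - G) / (F + K + (F - G) + 2 * \<bar>G\<bar>)"
  have den: "F + K + (F - G) + 2 * \<bar>G\<bar> > 0" using FG K0 F0 by linarith
  have t: "0 < t" "t \<le> 1" unfolding t_def using den FG K0 F0 by (auto simp: field_simps)
  have "t * (F + K + (F - G) + 2 * \<bar>G\<bar>) = F - G" using den by (simp add: t_def)
  moreover have "t * (F - 2 * G + K) \<le> t * (F + K + (F - G) + 2 * \<bar>G\<bar>)"
    using t FG by (intro mult_left_mono) auto
  ultimately have "t * (F - 2 * G + K) \<le> F - G" by simp
  then have "t * (t * (F - 2 * G + K)) \<le> t * (F - G)" using t by (intro mult_left_mono) auto
  moreover have "0 \<le> -2 * t * (F - G) + t * (t * (F - 2 * G + K))"
    using *[of t] t by (simp add: algebra_simps power2_eq_square)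
  moreover have "t * (F - G) > 0" using t FG by simp
  ultimately show False by (simp add: algebra_simps)
qed

text \<open>A point of weight zero may change its part without affecting any part sum. Its pairings
  with the deviations add up to zero over the parts, so some part has a nonpositive pairing. After a
  move to that part, the first-order condition bounds the spread above by this pairing.\<close>

lemma minimiser_with_zero_weight:
  assumes \<sigma>: "\<forall>i\<le>N. \<sigma> i \<le> k" and w: "w \<in> weights"
    and min: "\<And>\<tau> v. \<forall>i\<le>N. \<tau> i \<le> k \<Longrightarrow> v \<in> weights \<Longrightarrow> spread \<sigma> w w \<le> spread \<tau> v v"
    and i: "i \<le> N" "w i = 0"
  shows "spread \<sigma> w w = 0"
proof (rule ccontr)
  assume "\<not> ?thesis"
  then have pos: "spread \<sigma> w w > 0" using spread_nonneg[of \<sigma> w] by linarith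
  have "(\<Sum>j\<le>k. \<Sum>c\<in>C. x i c * deviation \<sigma> w j c) = (\<Sum>c\<in>C. x i c * (\<Sum>j\<le>k. deviation \<sigma> w j c))"
    by (subst sum.swap) (simp add: sum_distrib_left)
  also have "\<dots> = 0" by (simp add: sum_deviation)
  finally have "\<not> (\<forall>j\<in>{..k}. 0 < (\<Sum>c\<in>C. x i c * deviation \<sigma> w j c))"
    using sum_pos[of "{..k}" "\<lambda>j. \<Sum>c\<in>C. x i c * deviation \<sigma> w j c"] by auto
  then obtain j where j: "j \<le> k" "(\<Sum>c\<in>C. x i c * deviation \<sigma> w j c) \<le> 0" by (auto simp: not_less)
  define \<tau> where "\<tau> = \<sigma>(i := j)"
  have \<tau>: "\<forall>l\<le>N. \<tau> l \<le> k" using \<sigma> j by (simp add: \<tau>_def)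
  have "part_sum \<tau> w = part_sum \<sigma> w"
    unfolding part_sum_def fun_eq_iff using i by (auto simp: \<tau>_def intro!: sum.cong)
  then have d: "deviation \<tau> w = deviation \<sigma> w" "spread \<tau> w w = spread \<sigma> w w"
    by (auto simp: deviation_def spread_def fun_eq_iff)
  have "spread \<tau> w w \<le> spread \<tau> (\<lambda>l. of_bool (l = i)) w"
    by (rule minimiser_first_order[OF w i(1)]) (use min[OF \<tau>] d in simp)
  also have "\<dots> = (\<Sum>c\<in>C. x i c * deviation \<tau> w (\<tau> i) c)" by (rule spread_single) (use i \<tau> in auto)
  also have "\<dots> \<le> 0" using j d by (simp add: \<tau>_def)
  finally show False using pos d by simp
qed

text \<open>If the minimum were positive, all weights would be positive. A dimension count gives a
  nonzero direction that shifts all part sums equally; it changes neither the spread nor, by the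
  first-order conditions, the total weight. Following it until a weight vanishes yields a minimiser
  to which \<open>minimiser_with_zero_weight\<close> applies.\<close>

lemma minimal_spread_eq_0:
  assumes N: "N = k * card C"
    and \<sigma>: "\<forall>i\<le>N. \<sigma> i \<le> k" and w: "w \<in> weights"
    and min: "\<And>\<tau> v. \<forall>i\<le>N. \<tau> i \<le> k \<Longrightarrow> v \<in> weights \<Longrightarrow> spread \<sigma> w w \<le> spread \<tau> v v"
  shows "spread \<sigma> w w = 0"
proof (rule ccontr)
  assume nz: "spread \<sigma> w w \<noteq> 0"
  have pos: "w i > 0" if "i \<le> N" for i
  proof -
    have "w i \<noteq> 0" using minimiser_with_zero_weight[OF \<sigma> w min that] nz by auto
    then show ?thesis using w that by (force simp: weights_def)
  qed
  define g where "g i = spread \<sigma> (\<lambda>l. of_bool (l = i)) w - spread \<sigma> w w" for i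
  have g0: "0 \<le> g i" if "i \<le> N" for i
    using minimiser_first_order[OF w that min[OF \<sigma>]] by (simp add: g_def)
  have "(\<Sum>i\<le>N. w i * g i) = (\<Sum>i\<le>N. w i * spread \<sigma> (\<lambda>l. of_bool (l = i)) w) - (\<Sum>i\<le>N. w i) * spread \<sigma> w w"
    by (simp add: g_def right_diff_distrib sum_subtractf sum_distrib_right)
  also have "\<dots> = 0" using spread_expand[OF \<sigma>, of w w] w by (simp add: weights_def)
  \<comment> \<open>The \<open>w\<close>-weighted average of the nonnegative slacks
    \<open>g i\<close> is zero and all weights are positive, so every first-order inequality is an
    equality.\<close>
  finally have g: "g i = 0" if "i \<le> N" for i
    using that pos g0 by (subst (asm) sum_nonneg_eq_0_iff) (auto intro: less_imp_le simp: less_imp_neq[symmetric], fastforce)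
  \<comment> \<open>Each of the parts below \<open>k\<close> is compared with part \<open>k\<close>
    in every coordinate: \<open>k * card C\<close> equations against \<open>N + 1\<close> unknowns.
    This count is what fixes the number of points.\<close>
  have "card ({..<k} \<times> C) < card {..N}" by (simp add: N card_cartesian_product)
  then obtain \<mu> where \<mu>: "\<exists>i\<in>{..N}. \<mu> i \<noteq> 0" "\<And>q. q \<in> {..<k} \<times> C \<Longrightarrow>
      (\<Sum>i\<le>N. (of_bool (\<sigma> i = fst q) - of_bool (\<sigma> i = k)) * x i (snd q) * \<mu> i) = 0"
    using underdetermined_system_nontrivial_solution[of "{..<k} \<times> C" "{..N}"
        "\<lambda>q i. (of_bool (\<sigma> i = fst q) - of_bool (\<sigma> i = k)) * x i (snd q)"] finite_C by auto
  define \<delta> where "\<delta> i = of_bool (i \<le> N) * \<mu> i" for i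
  have ps: "part_sum \<sigma> \<delta> j c = part_sum \<sigma> \<delta> k c" if "j \<le> k" "c \<in> C" for j c
  proof (cases "j = k")
    case False
    then have "(\<Sum>i\<le>N. (of_bool (\<sigma> i = j) - of_bool (\<sigma> i = k)) * x i c * \<mu> i) = 0"
      using \<mu>(2)[of "(j,c)"] that by simp
    then show ?thesis by (simp add: part_sum_def \<delta>_def left_diff_distrib sum_subtractf)
  qed auto
  have dev0: "deviation \<sigma> \<delta> j c = 0" if "j \<le> k" "c \<in> C" for j c
  proof -
    have "(\<Sum>l\<le>k. part_sum \<sigma> \<delta> l c) = (\<Sum>l\<le>k. part_sum \<sigma> \<delta> k c)"
      by (intro sum.cong ps) (use that in auto)
    then show ?thesis using ps[OF that] by (simp add: deviation_def)
  qed
  have sp0: "spread \<sigma> v \<delta> = 0" for v by (simp add: spread_def dev0)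
  have sp0': "spread \<sigma> \<delta> v = 0" for v using sp0 spread_sym by metis
  \<comment> \<open>The pairing of \<open>\<delta>\<close> with \<open>w\<close> is zero, yet by the
    first-order equalities it is the total of \<open>\<delta>\<close> times the positive
    spread.\<close>
  have "0 = (\<Sum>i\<le>N. \<delta> i * spread \<sigma> (\<lambda>l. of_bool (l = i)) w)"
    using spread_expand[OF \<sigma>, of \<delta> w] sp0'[of w] by simp
  also have "\<dots> = (\<Sum>i\<le>N. \<delta> i * spread \<sigma> w w)" using g by (intro sum.cong) (auto simp: g_def)
  also have "\<dots> = (\<Sum>i\<le>N. \<delta> i) * spread \<sigma> w w" by (simp add: sum_distrib_right)
  finally have sum0: "(\<Sum>i\<le>N. \<delta> i) = 0" using nz by simp
  have "\<exists>i\<in>{..N}. \<delta> i < 0"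
  proof (rule ccontr)
    assume "\<not> ?thesis"
    then have nn: "0 \<le> \<delta> i" if "i \<in> {..N}" for i using that by (simp add: not_less)
    have "\<forall>i\<in>{..N}. \<delta> i = 0"
      using sum0 sum_nonneg_eq_0_iff[of "{..N}" \<delta>] nn by simp
    then show False using \<mu>(1) by (auto simp: \<delta>_def)
  qed
  then have T: "finite {i\<in>{..N}. \<delta> i < 0}" "{i\<in>{..N}. \<delta> i < 0} \<noteq> {}" by auto
  \<comment> \<open>A ratio test as in the simplex method: \<open>m\<close> is an index whose weight
    is the first to reach zero along \<open>\<delta>\<close>.\<close>
  obtain m where m: "m \<le> N" "\<delta> m < 0"
    and mmin: "\<And>i. i \<le> N \<Longrightarrow> \<delta> i < 0 \<Longrightarrow> w m / (- \<delta> m) \<le> w i / (- \<delta> i)"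
    using ex_is_arg_min_if_finite[OF T, of "\<lambda>i. w i / (- \<delta> i)"]
    unfolding is_arg_min_linorder by blast
  define t where "t = w m / (- \<delta> m)"
  have t: "t > 0" using m pos by (simp add: t_def divide_pos_neg)
  define v where "v = (\<lambda>i. 1 * w i + t * \<delta> i)"
  have "0 \<le> v i" if "i \<le> N" for i
  proof (cases "\<delta> i < 0")
    case True
    have "t \<le> w i / (- \<delta> i)" using mmin[OF that True] by (simp only: t_def)
    then have "t * (- \<delta> i) \<le> w i" using True by (simp only: pos_le_divide_eq neg_0_less_iff_less)
    then show ?thesis by (simp add: v_def)
  next
    case False
    then show ?thesis using t pos[OF that] by (simp add: v_def)
  qed
  moreover have "(\<Sum>i\<le>N. v i) = 1"
    using w sum0 by (simp add: v_def weights_def sum.distrib sum_distrib_left[symmetric])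
  ultimately have vw: "v \<in> weights" using w by (auto simp: weights_def v_def \<delta>_def)
  have sv: "spread \<sigma> v v = spread \<sigma> w w"
    unfolding v_def spread_lin spread_lin2 by (simp add: sp0 sp0')
  have "spread \<sigma> v v = 0"
  proof (rule minimiser_with_zero_weight[OF \<sigma> vw _ m(1)])
    show "v m = 0" using m by (simp add: v_def t_def)
    show "spread \<sigma> v v \<le> spread \<tau> u u" if "\<forall>i\<le>N. \<tau> i \<le> k" "u \<in> weights" for \<tau> u
      unfolding sv by (rule min[OF that])
  qed
  then show False using sv nz by simp
qed

end

text \<open>The conical form of Tverberg's theorem; adding a constant coordinate to the points gives the
  affine one. Following Sarkaria's proof, the partition and the weights minimise the total squared
  distance between the sums over the parts.\<close>

lemma conical_Tverberg:
  fixes x :: "nat \<Rightarrow> 'c \<Rightarrow> real"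
  assumes "finite C"
  obtains \<sigma> :: "nat \<Rightarrow> nat" and w :: "nat \<Rightarrow> real" and y :: "'c \<Rightarrow> real"
  where "\<And>i. 0 \<le> w i" "\<exists>i\<le>k * card C. 0 < w i" "\<And>i. i \<le> k * card C \<Longrightarrow> \<sigma> i \<le> k"
    "\<And>j c. j \<le> k \<Longrightarrow> c \<in> C \<Longrightarrow> (\<Sum>i\<le>k * card C. of_bool (\<sigma> i = j) * x i c * w i) = y c"
proof -
  interpret coloured_points x C k "k * card C" using assms by unfold_locales
  obtain \<sigma> w where \<sigma>: "\<forall>i\<le>k * card C. \<sigma> i \<le> k" and w: "w \<in> weights"
    and min: "\<And>\<tau> v. \<forall>i\<le>k * card C. \<tau> i \<le> k \<Longrightarrow> v \<in> weights \<Longrightarrow> spread \<sigma> w w \<le> spread \<tau> v v"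
    by (rule exists_minimiser) blast
  have 0: "spread \<sigma> w w = 0" by (rule minimal_spread_eq_0[OF refl \<sigma> w min])
  show thesis
  proof (rule that[of w \<sigma> "\<lambda>c. (\<Sum>l\<le>k. part_sum \<sigma> w l c) / real (k + 1)"])
    show "0 \<le> w i" for i using w by (cases "i \<le> k * card C") (auto simp: weights_def)
    show "\<exists>i\<le>k * card C. 0 < w i"
    proof (rule ccontr)
      assume "\<not> ?thesis"
      then have "(\<Sum>i\<le>k * card C. w i) \<le> 0" by (intro sum_nonpos) (auto simp: not_less)
      then show False using w by (simp add: weights_def)
    qed
    show "\<sigma> i \<le> k" if "i \<le> k * card C" for i using \<sigma> that by simp
    fix j c assume jc: "j \<le> k" "c \<in> C"
    have "deviation \<sigma> w j c = 0" by (rule spread_eq_0D[OF 0 jc])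
    then show "(\<Sum>i\<le>k * card C. of_bool (\<sigma> i = j) * x i c * w i) = (\<Sum>l\<le>k. part_sum \<sigma> w l c) / real (k + 1)"
      unfolding deviation_def part_sum_def[symmetric] by (simp add: field_simps)
  qed
qed

section \<open>Spans, dimension and rank\<close>

context vectorspace
begin

text \<open>A minimal generating subset is a basis, so its cardinality is the dimension. The later
  dimension arguments rest on this selection from a given finite family, which lets the chosen basis
  inherit properties of the family.\<close>

lemma subspace_generating_subset:
  assumes W: "VectorSpace.subspace K W V" and S: "finite S" "S \<subseteq> W" "W \<subseteq> span S"
  obtains T where "T \<subseteq> S" "card T = vectorspace.dim K (vs W)" "W \<subseteq> span T"
proof -
  interpret W: vectorspace K "vs W" by (rule subspace_is_vs[OF W])
  have sub: "submodule K W V" using W by simp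
  have "W.gen_set S"
  proof
    show "W.span S \<subseteq> carrier (vs W)" using S W.span_is_subset2[of S] by simp
    show "carrier (vs W) \<subseteq> W.span S" using S(3) span_li_not_depend(1)[OF S(2) sub] by simp
  qed
  then obtain T where T: "T \<subseteq> S" "minimal T (\<lambda>S. S \<subseteq> carrier (vs W) \<and> W.gen_set S)"
    using minimal_exists[of S "\<lambda>S. S \<subseteq> carrier (vs W) \<and> W.gen_set S"] S by auto
  have b: "W.basis T" by (rule W.min_gen_is_basis[OF T(2)])
  show thesis
  proof
    show "T \<subseteq> S" by (rule T)
    show "card T = W.dim" using W.dim_basis[OF finite_subset[OF T(1) S(1)] b] by simp
    have "T \<subseteq> W" using T S by auto
    then show "W \<subseteq> span T" using b span_li_not_depend(1)[OF _ sub, of T] by (auto simp: W.basis_def)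
  qed
qed

text \<open>Independent subsets of \<open>W\<close> stay independent in the whole space, hence have
  bounded size; a maximal one generates \<open>W\<close>.\<close>

lemma subspace_finite_generating_set:
  assumes W: "VectorSpace.subspace K W V" and fd: fin_dim
  obtains S where "finite S" "S \<subseteq> W" "W \<subseteq> span S"
proof -
  interpret W: vectorspace K "vs W" by (rule subspace_is_vs[OF W])
  have sub: "submodule K W V" using W by simp
  have WV: "W \<subseteq> carrier V" using sub by (simp add: submodule_def)
  have li: "lin_indpt S" if "S \<subseteq> W" "W.lin_indpt S" for S
    using that span_li_not_depend(2)[OF that(1) sub] by simp
  have "\<exists>T. finite T \<and> maximal T (\<lambda>S. S \<subseteq> carrier (vs W) \<and> W.lin_indpt S)"
  proof (rule maximal_exists)
    fix S assume "S \<subseteq> carrier (vs W) \<and> W.lin_indpt S"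
    then have "S \<subseteq> carrier V" "lin_indpt S" using li[of S] WV by auto
    then show "finite S \<and> card S \<le> dim" using li_le_dim[OF fd] by blast
  next
    show "{} \<subseteq> carrier (vs W) \<and> W.lin_indpt {}" by (auto simp: W.lin_dep_def)
  qed
  then obtain T where T: "finite T" "maximal T (\<lambda>S. S \<subseteq> carrier (vs W) \<and> W.lin_indpt S)" by blast
  have g: "W.gen_set T" by (rule W.max_li_is_gen[OF T(2)])
  have TW: "T \<subseteq> W" using T(2) by (auto simp: maximal_def)
  show thesis using that[of T] T TW g span_li_not_depend(1)[OF TW sub] by simp
qed

end

section \<open>Spans of matrices and their entries\<close>

context matrix_vs
begin

lemma lincomb_index:
  assumes "S \<subseteq> carrier_mat nr nc" "i < nr" "j < nc"
  shows "lincomb a S $$ (i, j) = (\<Sum>b\<in>S. a b * b $$ (i, j))"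
  using assms(1)
proof (induction S rule: infinite_finite_induct)
  case (infinite S)
  then show ?case using assms by (simp add: lincomb_def)
next
  case empty
  then show ?case using assms by simp
next
  case (insert b S)
  have "lincomb a (insert b S) = a b \<cdot>\<^sub>m b + lincomb a S"
    using insert by (subst lincomb_insert2) auto
  moreover have "dim_row (lincomb a S) = nr" "dim_col (lincomb a S) = nc"
    using lincomb_closed[of S a] insert by (auto simp del: lincomb_closed)
  ultimately show ?case using insert assms by auto
qed

lemma in_spanI:
  assumes "finite S" "S \<subseteq> carrier_mat nr nc" "A \<in> carrier_mat nr nc"
    and "\<And>i j. i < nr \<Longrightarrow> j < nc \<Longrightarrow> A $$ (i, j) = (\<Sum>b\<in>S. a b * b $$ (i, j))"
  shows "A \<in> span S"
proof -
  have "dim_row (lincomb a S) = nr" "dim_col (lincomb a S) = nc"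
    using lincomb_closed[of S a] assms(2) by (auto simp del: lincomb_closed)
  then have "A = lincomb a S" using assms by (intro eq_matI) (auto simp: lincomb_index)
  then show ?thesis using assms by (auto simp: span_def)
qed

lemma in_spanE:
  assumes "A \<in> span S" "finite S" "S \<subseteq> carrier_mat nr nc"
  obtains a where "\<And>i j. i < nr \<Longrightarrow> j < nc \<Longrightarrow> A $$ (i, j) = (\<Sum>b\<in>S. a b * b $$ (i, j))"
proof -
  obtain a where "A = lincomb a S" using assms finite_span by auto
  then show thesis using that[of a] assms by (simp add: lincomb_index)
qed

lemma fin_dim: fin_dim
proof -
  define u :: "nat \<times> nat \<Rightarrow> 'a mat" where "u p = mat nr nc (\<lambda>q. of_bool (p = q))" for p
  define I where "I = {..<nr} \<times> {..<nc}"
  have I: "finite I" by (simp add: I_def)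
  have inj: "inj_on u I"
  proof
    fix p q assume pq: "p \<in> I" "q \<in> I" "u p = u q"
    have "u p $$ p = u q $$ p" using pq by simp
    moreover have "u p $$ p = 1" "u q $$ p = of_bool (q = p)" using pq(1) by (auto simp: u_def I_def)
    ultimately show "p = q" by (simp split: if_splits)
  qed
  have "A \<in> span (u ` I)" if A: "A \<in> carrier_mat nr nc" for A
  \<comment> \<open>The matrix units \<open>u p\<close> generate. Coefficients are indexed by the
    matrices themselves, so the position of a unit is recovered through the inverse of
    \<open>u\<close>.\<close>
  proof (rule in_spanI[where a = "\<lambda>m. A $$ the_inv_into I u m"])
    fix i j assume ij: "i < nr" "j < nc"
    have "(\<Sum>b\<in>u ` I. A $$ the_inv_into I u b * b $$ (i, j)) = (\<Sum>p\<in>I. A $$ p * u p $$ (i, j))"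
      by (subst sum.reindex[OF inj]) (auto simp: the_inv_into_f_f[OF inj] intro!: sum.cong)
    also have "\<dots> = (\<Sum>p\<in>I. if p = (i, j) then A $$ p else 0)"
      using ij by (intro sum.cong) (auto simp: u_def)
    also have "\<dots> = A $$ (i, j)" using I ij by (simp add: I_def)
    finally show "A $$ (i, j) = (\<Sum>b\<in>u ` I. A $$ the_inv_into I u b * b $$ (i, j))" ..
  qed (use A I in \<open>auto simp: u_def\<close>)
  moreover have "span (u ` I) \<subseteq> carrier_mat nr nc" by (rule span_is_subset2) (auto simp: u_def)
  ultimately show ?thesis unfolding fin_dim_def using I
    by (intro exI[of _ "u ` I"]) (auto simp: u_def)
qed

end

text \<open>The linear span in terms of scalar equations, so that memberships can be substituted
  directly into sums over entries.\<close>

definition entrywise_span :: "nat \<Rightarrow> complex mat set \<Rightarrow> complex mat set" where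
  "entrywise_span n S = {A \<in> carrier_mat n n. \<exists>a. \<forall>i<n. \<forall>j<n. A $$ (i, j) = (\<Sum>b\<in>S. a b * b $$ (i, j))}"

lemma entrywise_span_eq_span:
  assumes "finite S" "S \<subseteq> carrier_mat n n"
  shows "entrywise_span n S = LinearCombinations.module.span class_ring (module_mat TYPE(complex) n n) S"
proof -
  interpret M: matrix_vs n n "TYPE(complex)" .
  have "A \<in> M.span S" if A: "A \<in> entrywise_span n S" for A
  proof -
    obtain a where "\<forall>i<n. \<forall>j<n. A $$ (i, j) = (\<Sum>b\<in>S. a b * b $$ (i, j))"
      using A by (auto simp: entrywise_span_def)
    then show ?thesis using A assms by (intro M.in_spanI[where a = a]) (auto simp: entrywise_span_def)
  qed
  moreover have "A \<in> entrywise_span n S" if A: "A \<in> M.span S" for A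
  proof -
    have "A \<in> carrier_mat n n" using A M.span_is_subset2[OF assms(2)] by auto
    moreover obtain a where "\<And>i j. i < n \<Longrightarrow> j < n \<Longrightarrow> A $$ (i, j) = (\<Sum>b\<in>S. a b * b $$ (i, j))"
      by (rule M.in_spanE[OF A assms]) blast
    ultimately show ?thesis unfolding entrywise_span_def by (intro CollectI conjI exI[of _ a]) auto
  qed
  ultimately show ?thesis by blast
qed

abbreviation mat_subspace :: "nat \<Rightarrow> complex mat set \<Rightarrow> bool" where
  "mat_subspace n W \<equiv> VectorSpace.subspace class_ring W (module_mat TYPE(complex) n n)"

lemma mat_subspace_iff:
  "mat_subspace n W \<longleftrightarrow> W \<subseteq> carrier_mat n n \<and> 0\<^sub>m n n \<in> W \<and>
     (\<forall>A\<in>W. \<forall>B\<in>W. A + B \<in> W) \<and> (\<forall>c. \<forall>A\<in>W. c \<cdot>\<^sub>m A \<in> W)"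
proof -
  interpret M: matrix_vs n n "TYPE(complex)" .
  show ?thesis
    unfolding VectorSpace.subspace_def submodule_def
    using M.vectorspace_axioms M.module_axioms by (auto simp: matrix_vs_simps)
qed

lemma mat_subspace_generating_subset:
  assumes W: "mat_subspace n W" and S: "finite S" "S \<subseteq> W" "W \<subseteq> entrywise_span n S"
  obtains T where "T \<subseteq> S" "card T = mat_space_dim n W" "W \<subseteq> entrywise_span n T"
proof -
  interpret M: matrix_vs n n "TYPE(complex)" .
  have Sc: "S \<subseteq> carrier_mat n n" using S W by (auto simp: mat_subspace_iff)
  obtain T where T: "T \<subseteq> S" "card T = mat_space_dim n W" "W \<subseteq> M.span T"
    using M.subspace_generating_subset[OF W S(1,2)] S(3)
    unfolding entrywise_span_eq_span[OF S(1) Sc] mat_space_dim_def by blast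
  moreover have "finite T" using T S by (simp add: finite_subset)
  moreover have "T \<subseteq> carrier_mat n n" using T Sc by auto
  ultimately show thesis using that[of T] entrywise_span_eq_span[of T n] by simp
qed

lemma mat_subspace_finite_generating_set:
  assumes W: "mat_subspace n W"
  obtains S where "finite S" "S \<subseteq> W" "W \<subseteq> entrywise_span n S"
proof -
  interpret M: matrix_vs n n "TYPE(complex)" .
  obtain S where S: "finite S" "S \<subseteq> W" "W \<subseteq> M.span S"
    using M.subspace_finite_generating_set[OF W M.fin_dim] .
  moreover have "S \<subseteq> carrier_mat n n" using S W by (auto simp: mat_subspace_iff)
  ultimately show thesis using that[of S] entrywise_span_eq_span[of S n] by simp
qed

text \<open>The rank is the dimension of the column space, which is the image of \<open>P\<close>. A
  finite family in the image that generates it therefore contains a basis with \<open>rank P\<close>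
  elements; this yields the exact rank of a frame projection and the upper bound on the rank of an
  anticlique.\<close>

lemma (in vec_space) rank_generating_subset:
  assumes P: "P \<in> carrier_mat n nc" and S: "finite S" "\<And>v. v \<in> S \<Longrightarrow> \<exists>y\<in>carrier_vec nc. v = P *\<^sub>v y"
    and gen: "\<And>y. y \<in> carrier_vec nc \<Longrightarrow> \<exists>a. \<forall>i<n. (P *\<^sub>v y) $ i = (\<Sum>v\<in>S. a v * v $ i)"
  obtains T where "T \<subseteq> S" "card T = rank P"
    "\<And>y. y \<in> carrier_vec nc \<Longrightarrow> \<exists>a. \<forall>i<n. (P *\<^sub>v y) $ i = (\<Sum>v\<in>T. a v * v $ i)"
proof -
  let ?W = "span (set (cols P))"
  have c: "set (cols P) \<subseteq> carrier_vec n" using P cols_dim by blast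
  have W: "VectorSpace.subspace class_ring ?W V" using span_is_subspace c by simp
  have Weq: "?W = {P *\<^sub>v y | y. y \<in> carrier_vec nc}"
    using col_space_eq[OF P] P by (auto simp: col_space_def)
  have Sc: "S \<subseteq> carrier_vec n" using S(2) P by fastforce
  have "P *\<^sub>v y \<in> span S" if y: "y \<in> carrier_vec nc" for y
  proof -
    obtain a where a: "\<forall>i<n. (P *\<^sub>v y) $ i = (\<Sum>v\<in>S. a v * v $ i)" using gen[OF y] by auto
    have "P *\<^sub>v y = lincomb a S"
      using a P lincomb_dim[OF S(1) Sc] by (intro eq_vecI) (auto simp: lincomb_index[OF _ Sc])
    then show ?thesis using S by (auto simp: span_def)
  qed
  then have WS: "?W \<subseteq> span S" unfolding Weq by auto
  have SW: "S \<subseteq> ?W" using S(2) unfolding Weq by blast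
  obtain T where T: "T \<subseteq> S" "card T = vectorspace.dim class_ring (vs ?W)" "?W \<subseteq> span T"
    using subspace_generating_subset[OF W S(1) SW WS] .
  have fT: "finite T" and Tc: "T \<subseteq> carrier_vec n" using T S Sc by (auto simp: finite_subset)
  show thesis
  proof
    show "card T = rank P" using T by (simp add: rank_def)
    fix y :: "'a vec" assume "y \<in> carrier_vec nc"
    then have "P *\<^sub>v y \<in> span T" using T(3) unfolding Weq by blast
    then obtain a where "P *\<^sub>v y = lincomb a T" using finite_span fT Tc by auto
    then show "\<exists>a. \<forall>i<n. (P *\<^sub>v y) $ i = (\<Sum>v\<in>T. a v * v $ i)"
      using lincomb_index[OF _ Tc] by auto
  qed (rule T)
qed

section \<open>Orthogonal sequences for operator systems\<close>

lemma mat_adjoint_carrier: "A \<in> carrier_mat m n \<Longrightarrow> mat_adjoint A \<in> carrier_mat n m"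
  by (auto simp: mat_adjoint_def)

lemma mat_adjoint_index:
  fixes A :: "complex mat"
  assumes "i < dim_col A" "j < dim_row A"
  shows "mat_adjoint A $$ (i, j) = cnj (A $$ (j, i))"
  using assms by (simp add: mat_adjoint_def mat_of_rows_index)

text \<open>The form \<open>\<langle>x, A y\<rangle>\<close>, conjugate-linear in \<open>x\<close>.
  Vectors are plain functions, of which the entries below \<open>n\<close> count, so that
  superpositions are ordinary sums.\<close>

definition sesq :: "nat \<Rightarrow> complex mat \<Rightarrow> (nat \<Rightarrow> complex) \<Rightarrow> (nat \<Rightarrow> complex) \<Rightarrow> complex" where
  "sesq n A x y = (\<Sum>i<n. \<Sum>j<n. cnj (x i) * A $$ (i, j) * y j)"

lemma sesq_hermitian:
  assumes "A \<in> carrier_mat n n" "mat_adjoint A = A"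
  shows "sesq n A y x = cnj (sesq n A x y)"
proof -
  have h: "A $$ (i, j) = cnj (A $$ (j, i))" if "i < n" "j < n" for i j
    using mat_adjoint_index[of i A j] assms that by auto
  have "sesq n A y x = (\<Sum>i<n. \<Sum>j<n. cnj (cnj (x j) * A $$ (j, i) * y i))"
    unfolding sesq_def
  proof (intro sum.cong refl)
    fix i j assume "i \<in> {..<n}" "j \<in> {..<n}"
    then show "cnj (y i) * A $$ (i, j) * x j = cnj (cnj (x j) * A $$ (j, i) * y i)"
      using h[of i j] by simp
  qed
  also have "\<dots> = cnj (sesq n A x y)" unfolding sesq_def cnj_sum by (rule sum.swap)
  finally show ?thesis .
qed

lemma sesq_combination:
  assumes "\<And>i j. i < n \<Longrightarrow> j < n \<Longrightarrow> A $$ (i, j) = (\<Sum>b\<in>S. a b * b $$ (i, j))"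
  shows "sesq n A x y = (\<Sum>b\<in>S. a b * sesq n b x y)"
proof -
  have "sesq n A x y = (\<Sum>i<n. \<Sum>j<n. \<Sum>b\<in>S. a b * (cnj (x i) * b $$ (i, j) * y j))"
    unfolding sesq_def
    by (intro sum.cong refl) (simp add: assms sum_distrib_left sum_distrib_right algebra_simps)
  also have "\<dots> = (\<Sum>i<n. \<Sum>b\<in>S. \<Sum>j<n. a b * (cnj (x i) * b $$ (i, j) * y j))"
    by (intro sum.cong refl sum.swap)
  also have "\<dots> = (\<Sum>b\<in>S. \<Sum>i<n. \<Sum>j<n. a b * (cnj (x i) * b $$ (i, j) * y j))"
    by (rule sum.swap)
  finally show ?thesis by (simp add: sesq_def sum_distrib_left)
qed

lemma sesq_sum_left:
  "sesq n A (\<lambda>i. \<Sum>s\<in>I. \<alpha> s * u s i) y = (\<Sum>s\<in>I. cnj (\<alpha> s) * sesq n A (u s) y)"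
proof -
  have "sesq n A (\<lambda>i. \<Sum>s\<in>I. \<alpha> s * u s i) y
      = (\<Sum>i<n. \<Sum>j<n. \<Sum>s\<in>I. cnj (\<alpha> s) * (cnj (u s i) * A $$ (i, j) * y j))"
    unfolding sesq_def by (intro sum.cong refl) (simp add: sum_distrib_left sum_distrib_right algebra_simps)
  also have "\<dots> = (\<Sum>i<n. \<Sum>s\<in>I. \<Sum>j<n. cnj (\<alpha> s) * (cnj (u s i) * A $$ (i, j) * y j))"
    by (intro sum.cong refl sum.swap)
  also have "\<dots> = (\<Sum>s\<in>I. \<Sum>i<n. \<Sum>j<n. cnj (\<alpha> s) * (cnj (u s i) * A $$ (i, j) * y j))"
    by (rule sum.swap)
  finally show ?thesis by (simp add: sesq_def sum_distrib_left)
qed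

lemma sesq_sum_right:
  "sesq n A x (\<lambda>i. \<Sum>s\<in>I. \<alpha> s * u s i) = (\<Sum>s\<in>I. \<alpha> s * sesq n A x (u s))"
proof -
  have "sesq n A x (\<lambda>i. \<Sum>s\<in>I. \<alpha> s * u s i)
      = (\<Sum>i<n. \<Sum>j<n. \<Sum>s\<in>I. \<alpha> s * (cnj (x i) * A $$ (i, j) * u s j))"
    unfolding sesq_def by (intro sum.cong refl) (simp add: sum_distrib_left sum_distrib_right algebra_simps)
  also have "\<dots> = (\<Sum>i<n. \<Sum>s\<in>I. \<Sum>j<n. \<alpha> s * (cnj (x i) * A $$ (i, j) * u s j))"
    by (intro sum.cong refl sum.swap)
  also have "\<dots> = (\<Sum>s\<in>I. \<Sum>i<n. \<Sum>j<n. \<alpha> s * (cnj (x i) * A $$ (i, j) * u s j))"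
    by (rule sum.swap)
  finally show ?thesis by (simp add: sesq_def sum_distrib_left)
qed

lemma sesq_one: "sesq n (1\<^sub>m n) x y = (\<Sum>i<n. cnj (x i) * y i)"
proof -
  have "(\<Sum>j<n. cnj (x i) * 1\<^sub>m n $$ (i, j) * y j) = cnj (x i) * y i" if "i < n" for i
  proof -
    have "(\<Sum>j<n. cnj (x i) * 1\<^sub>m n $$ (i, j) * y j) = (\<Sum>j<n. if j = i then cnj (x i) * y j else 0)"
      using that by (intro sum.cong) auto
    then show ?thesis using that by simp
  qed
  then show ?thesis by (simp add: sesq_def)
qed

lemma sesq_eigenvector:
  assumes "A \<in> carrier_mat n n" "eigenvector A v l"
  shows "sesq n A y (\<lambda>i. v $ i) = l * sesq n (1\<^sub>m n) y (\<lambda>i. v $ i)"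
proof -
  have v: "v \<in> carrier_vec n" and Av: "A *\<^sub>v v = l \<cdot>\<^sub>v v" using assms by (auto simp: eigenvector_def)
  have "(\<Sum>j<n. A $$ (i, j) * v $ j) = l * v $ i" if i: "i < n" for i
  proof -
    have "(\<Sum>j<n. A $$ (i, j) * v $ j) = (A *\<^sub>v v) $ i"
      using assms(1) v i by (simp add: scalar_prod_def lessThan_atLeast0)
    then show ?thesis using v i by (simp add: Av)
  qed
  then have "(\<Sum>j<n. cnj (y i) * A $$ (i, j) * v $ j) = l * (cnj (y i) * v $ i)" if "i < n" for i
    using that by (simp add: mult.assoc sum_distrib_left[symmetric])
  then show ?thesis by (simp add: sesq_one, simp add: sesq_def sum_distrib_left)
qed

text \<open>Taking an eigenvector of one member of a spanning family makes one of the orthogonality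
  conditions redundant. Without this saving the construction would be one vector short when
  \<open>n = k * d\<^sup>2\<close>.\<close>

lemma exists_vector_with_redundant_condition:
  assumes S: "finite S" "S \<subseteq> carrier_mat n n" "\<And>b. b \<in> S \<Longrightarrow> mat_adjoint b = b"
    and one: "1\<^sub>m n \<in> entrywise_span n S" and card: "2 \<le> card S" and n: "0 < n"
  obtains x b where "\<exists>i<n. x i \<noteq> 0" "b \<in> S"
    "\<And>y. \<forall>c\<in>S - {b}. sesq n c x y = 0 \<Longrightarrow> sesq n b x y = 0"
proof -
  obtain a where a: "\<And>i j. i < n \<Longrightarrow> j < n \<Longrightarrow> 1\<^sub>m n $$ (i, j) = (\<Sum>b\<in>S. a b * b $$ (i, j))"
    using one by (auto simp: entrywise_span_def)
  have "\<exists>b0\<in>S. a b0 \<noteq> 0" using a[of 0 0] n by (force intro: ccontr)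
  then obtain b0 where b0: "b0 \<in> S" "a b0 \<noteq> 0" by blast
  have "\<not> S \<subseteq> {b0}" using card card_mono[of "{b0}" S] by auto
  then obtain b1 where b1: "b1 \<in> S" "b1 \<noteq> b0" by blast
  have b1c: "b1 \<in> carrier_mat n n" using S b1 by blast
  obtain l where "eigenvalue b1 l" using spectrum_non_empty[OF b1c n] by (auto simp: spectrum_def)
  then obtain v where ev: "eigenvector b1 v l" by (auto simp: eigenvalue_def)
  define x where "x i = v $ i" for i
  \<comment> \<open>The coefficients of \<open>b1\<close> minus \<open>l\<close> times the identity,
    a matrix that annihilates the eigenvector \<open>x\<close>.\<close>
  define \<alpha> where "\<alpha> c = of_bool (c = b1) - l * a c" for c
  \<comment> \<open>The redundant condition must carry a nonzero coefficient: for
    \<open>l = 0\<close> that of \<open>b1\<close> is 1, otherwise that of \<open>b0\<close> is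
    \<open>- l * a b0\<close>.\<close>
  define b where "b = (if l = 0 then b1 else b0)"
  have \<alpha>: "\<alpha> b \<noteq> 0" using b0 b1 by (auto simp: \<alpha>_def b_def)
  have bS: "b \<in> S" using b0 b1 by (simp add: b_def)
  have comb: "(\<Sum>c\<in>S. \<alpha> c * sesq n c y x) = 0" for y
  proof -
    have "(\<Sum>c\<in>S. \<alpha> c * sesq n c y x)
        = (\<Sum>c\<in>S. (if c = b1 then sesq n c y x else 0)) - l * (\<Sum>c\<in>S. a c * sesq n c y x)"
      by (simp add: \<alpha>_def left_diff_distrib sum_subtractf sum_distrib_left mult.assoc of_bool_def
          if_distrib[of "\<lambda>u. u * _"] cong: if_cong)
    also have "(\<Sum>c\<in>S. (if c = b1 then sesq n c y x else 0)) = sesq n b1 y x" using S b1 by simp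
    also have "(\<Sum>c\<in>S. a c * sesq n c y x) = sesq n (1\<^sub>m n) y x"
      by (rule sesq_combination[symmetric]) (rule a)
    finally show ?thesis using sesq_eigenvector[OF b1c ev, of y] by (simp add: x_def[abs_def])
  qed
  show thesis
  proof
    show "\<exists>i<n. x i \<noteq> 0"
    proof (rule ccontr)
      assume "\<not> ?thesis"
      then have "v = 0\<^sub>v n" using ev b1c by (intro eq_vecI) (auto simp: eigenvector_def x_def)
      then show False using ev b1c by (simp add: eigenvector_def)
    qed
    show "b \<in> S" by (rule bS)
    fix y assume y: "\<forall>c\<in>S - {b}. sesq n c x y = 0"
    have herm: "sesq n c y x = cnj (sesq n c x y)" if "c \<in> S" for c
      using sesq_hermitian S that by blast
    have "0 = \<alpha> b * sesq n b y x + (\<Sum>c\<in>S - {b}. \<alpha> c * sesq n c y x)"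
      using comb[of y] sum.remove[OF S(1) bS, of "\<lambda>c. \<alpha> c * sesq n c y x"] by simp
    also have "(\<Sum>c\<in>S - {b}. \<alpha> c * sesq n c y x) = 0" using y herm by (intro sum.neutral) auto
    finally show "sesq n b x y = 0" using \<alpha> herm[OF bS] by simp
  qed
qed

text \<open>Greedy choice: each new vector solves a homogeneous system with \<open>card S\<close>
  equations per earlier vector, except that the conditions in \<open>S'\<close> suffice for the
  first one. The inequality says \<open>card S' + (m - 1) * card S < n\<close>, rearranged to avoid
  truncated subtraction at \<open>m = 0\<close>.\<close>

lemma exists_orthogonal_sequence:
  assumes fin: "finite S" "finite S'" and x: "\<exists>i<n. x i \<noteq> 0"
    and red: "\<And>y. \<forall>b\<in>S'. sesq n b x y = 0 \<Longrightarrow> \<forall>b\<in>S. sesq n b x y = 0"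
    and card: "card S' + m * card S < n + card S"
  shows "\<exists>e. e 0 = x \<and> (\<forall>s\<le>m. \<exists>i<n. e s i \<noteq> 0) \<and> (\<forall>s t. s < t \<longrightarrow> t \<le> m \<longrightarrow> (\<forall>b\<in>S. sesq n b (e s) (e t) = 0))"
  using card
proof (induction m)
  case 0
  then show ?case using x by (intro exI[of _ "\<lambda>_. x"]) auto
next
  case (Suc m)
  have "card S' + m * card S < n + card S" using Suc.prems by simp
  then obtain e where e: "e 0 = x" "\<forall>s\<le>m. \<exists>i<n. e s i \<noteq> 0"
    "\<forall>s t. s < t \<longrightarrow> t \<le> m \<longrightarrow> (\<forall>b\<in>S. sesq n b (e s) (e t) = 0)"
    using Suc.IH by blast
  define J where "J = {0} \<times> S' \<union> {1..m} \<times> S"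
  have "card J \<le> card ({0::nat} \<times> S') + card ({1..m} \<times> S)" unfolding J_def by (rule card_Un_le)
  also have "\<dots> = card S' + m * card S" by (simp add: card_cartesian_product)
  finally have "card J < card {..<n}" using Suc.prems by simp
  moreover have "finite J" using fin by (simp add: J_def)
  ultimately obtain y where y: "\<exists>j\<in>{..<n}. y j \<noteq> 0" "\<And>q. q \<in> J \<Longrightarrow>
      (\<Sum>j<n. (\<Sum>i<n. cnj (e (fst q) i) * snd q $$ (i, j)) * y j) = 0"
    using underdetermined_system_nontrivial_solution[of J "{..<n}"
        "\<lambda>q j. \<Sum>i<n. cnj (e (fst q) i) * snd q $$ (i, j)"] by blast
  have "sesq n b (e s) y = (\<Sum>j<n. (\<Sum>i<n. cnj (e s i) * b $$ (i, j)) * y j)" for b s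
    unfolding sesq_def sum_distrib_right by (rule sum.swap)
  then have yJ: "sesq n b (e s) y = 0" if "(s, b) \<in> J" for s b using y(2)[OF that] by simp
  have orth: "sesq n b (e s) y = 0" if "s \<le> m" "b \<in> S" for s b
  proof (cases "s = 0")
    case True
    then show ?thesis using red[of y] yJ[of 0] e(1) that by (simp add: J_def)
  next
    case False
    then show ?thesis using yJ[of s b] that by (simp add: J_def)
  qed
  show ?case
  proof (intro exI[of _ "e(Suc m := y)"] conjI allI impI ballI)
    fix s t b assume "s < t" "t \<le> Suc m" "b \<in> S"
    then show "sesq n b ((e(Suc m := y)) s) ((e(Suc m := y)) t) = 0"
      using e(3) orth[of s b] by (cases "t = Suc m") auto
  qed (use e y(1) in \<open>auto simp: le_Suc_eq\<close>)
qed

text \<open>Closure under adjoints puts the real and imaginary parts of a generating set into the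
  system. They generate it too, and a basis is selected among them.\<close>

lemma operator_system_hermitian_basis:
  assumes V: "operator_system n V"
  obtains S where "finite S" "S \<subseteq> V" "card S = mat_space_dim n V"
    "\<And>b. b \<in> S \<Longrightarrow> mat_adjoint b = b" "V \<subseteq> entrywise_span n S"
proof -
  interpret M: matrix_vs n n "TYPE(complex)" .
  have sub: "mat_subspace n V" and adj: "\<And>A. A \<in> V \<Longrightarrow> mat_adjoint A \<in> V"
    using V by (auto simp: operator_system_def)
  have Vc: "V \<subseteq> carrier_mat n n" and Vadd: "\<And>A B. A \<in> V \<Longrightarrow> B \<in> V \<Longrightarrow> A + B \<in> V"
    and Vsm: "\<And>c A. A \<in> V \<Longrightarrow> c \<cdot>\<^sub>m A \<in> V"
    using sub by (auto simp: mat_subspace_iff)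
  obtain S0 where S0: "finite S0" "S0 \<subseteq> V" "V \<subseteq> entrywise_span n S0"
    using mat_subspace_finite_generating_set[OF sub] .
  \<comment> \<open>Twice the real part and minus twice the imaginary part of \<open>b\<close>, so
    that \<open>b\<close> is \<open>re b / 2 - \<i> * im b / 2\<close>.\<close>
  define re im where "re b = b + mat_adjoint b" and "im b = \<i> \<cdot>\<^sub>m b + (- \<i>) \<cdot>\<^sub>m mat_adjoint b" for b
  define S1 where "S1 = re ` S0 \<union> im ` S0"
  have S1: "finite S1" "S1 \<subseteq> V" using S0 adj Vadd Vsm by (auto simp: S1_def re_def im_def)
  have S1c: "S1 \<subseteq> carrier_mat n n" using S1 Vc by blast
  have S0c: "S0 \<subseteq> carrier_mat n n" using S0 Vc by blast
  have herm: "mat_adjoint b = b" if "b \<in> S1" for b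
  proof -
    have "mat_adjoint (re c) = re c" "mat_adjoint (im c) = im c" if "c \<in> carrier_mat n n" for c
      using that mat_adjoint_carrier[OF that]
      by (auto simp: re_def im_def mat_adjoint_index intro!: eq_matI)
         (auto simp: mat_adjoint_def)
    then show ?thesis using \<open>b \<in> S1\<close> S0c by (auto simp: S1_def)
  qed
  have span: "mat_subspace n (M.span S1)" by (rule M.span_is_subspace) (use S1c in auto)
  have "S0 \<subseteq> M.span S1"
  proof
    fix b assume b: "b \<in> S0"
    have bc: "b \<in> carrier_mat n n" using b S0c by blast
    have "re b \<in> M.span S1" "im b \<in> M.span S1" using b S1c M.in_own_span[of S1] by (auto simp: S1_def)
    then have "(1/2) \<cdot>\<^sub>m re b + (- \<i>/2) \<cdot>\<^sub>m im b \<in> M.span S1"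
      using span by (auto simp: mat_subspace_iff)
    moreover have "(1/2) \<cdot>\<^sub>m re b + (- \<i>/2) \<cdot>\<^sub>m im b = b"
      using bc mat_adjoint_carrier[OF bc] by (intro eq_matI) (auto simp: re_def im_def algebra_simps)
    ultimately show "b \<in> M.span S1" by simp
  qed
  then have "M.span S0 \<subseteq> M.span S1" using span by (intro M.span_is_subset) auto
  then have "V \<subseteq> entrywise_span n S1"
    using S0(3) unfolding entrywise_span_eq_span[OF S0(1) S0c] entrywise_span_eq_span[OF S1(1) S1c] by blast
  then obtain T where T: "T \<subseteq> S1" "card T = mat_space_dim n V" "V \<subseteq> entrywise_span n T"
    using mat_subspace_generating_subset[OF sub S1] by blast
  show thesis
    using that[of T] T S1 herm finite_subset[OF T(1) S1(1)] by blast
qed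

text \<open>The greedy construction needs a strict inequality. If \<open>card S\<close> is at least
  2, the redundant condition for the first vector gains the missing unit; if it is 1, any first
  vector will do and \<open>k < n\<close> supplies strictness. As the members of \<open>S\<close>
  are Hermitian, orthogonality in one order implies it in the other.\<close>

lemma exists_orthogonal_frame:
  assumes S: "finite S" "S \<subseteq> carrier_mat n n" "\<And>b. b \<in> S \<Longrightarrow> mat_adjoint b = b"
    and one: "1\<^sub>m n \<in> entrywise_span n S" and large: "k * (card S)\<^sup>2 \<le> n" and k: "k < n"
  obtains e where "\<And>s. s \<le> k * card S \<Longrightarrow> \<exists>i<n. e s i \<noteq> 0"
    "\<And>s t b. s \<le> k * card S \<Longrightarrow> t \<le> k * card S \<Longrightarrow> s \<noteq> t \<Longrightarrow> b \<in> S \<Longrightarrow> sesq n b (e s) (e t) = 0"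
proof -
  have n: "0 < n" using k by simp
  have "card S \<noteq> 0"
  proof
    assume "card S = 0"
    then have "1\<^sub>m n \<in> entrywise_span n {}" using S one by simp
    then have "(1\<^sub>m n :: complex mat) $$ (0, 0) = 0" using n by (simp add: entrywise_span_def del: index_one_mat)
    then show False using n by simp
  qed
  then have "card S = 1 \<or> 2 \<le> card S" by linarith
  then obtain x S' where x: "\<exists>i<n. x i \<noteq> 0" "finite S'"
      "\<And>y. \<forall>b\<in>S'. sesq n b x y = 0 \<Longrightarrow> \<forall>b\<in>S. sesq n b x y = 0"
      "card S' + k * card S * card S < n + card S"
  proof
    assume "card S = 1"
    then show thesis using that[of "\<lambda>_. 1" S] n k S by auto
  next
    assume c: "2 \<le> card S"
    obtain x b where xb: "\<exists>i<n. x i \<noteq> 0" "b \<in> S"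
      "\<And>y. \<forall>c\<in>S - {b}. sesq n c x y = 0 \<Longrightarrow> sesq n b x y = 0"
      using exists_vector_with_redundant_condition[OF S one c n] by blast
    have "card (S - {b}) < card S" using S xb by (meson card_Diff1_less)
    then show thesis using that[of x "S - {b}"] xb large S by (fastforce simp: power2_eq_square mult.assoc)
  qed
  obtain e where e: "\<forall>s\<le>k * card S. \<exists>i<n. e s i \<noteq> 0"
    "\<forall>s t. s < t \<longrightarrow> t \<le> k * card S \<longrightarrow> (\<forall>b\<in>S. sesq n b (e s) (e t) = 0)"
    using exists_orthogonal_sequence[OF S(1) x(2,1,3,4)] by blast
  show thesis
  proof
    fix s t b assume st: "s \<le> k * card S" "t \<le> k * card S" "s \<noteq> t" "b \<in> S"
    have "sesq n b (e t) (e s) = cnj (sesq n b (e s) (e t))"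
      using sesq_hermitian S st by blast
    moreover have "sesq n b (e s) (e t) = 0 \<or> sesq n b (e t) (e s) = 0"
      using e(2) st by (meson linorder_neqE_nat)
    ultimately show "sesq n b (e s) (e t) = 0" by auto
  qed (use e(1) in auto)
qed

section \<open>Anticliques\<close>

lemma mat_mult_index_sum:
  assumes "A \<in> carrier_mat n m" "B \<in> carrier_mat m p" "i < n" "j < p"
  shows "(A * B) $$ (i, j) = (\<Sum>l<m. A $$ (i, l) * B $$ (l, j))"
  using assms by (simp add: scalar_prod_def lessThan_atLeast0)

text \<open>Coefficients of coinciding members are added up. One \<open>a\<close> serves every
  \<open>\<phi>\<close>, hence all entries of a vector or matrix at once.\<close>

lemma sum_over_image_combination:
  fixes \<alpha> :: "'b \<Rightarrow> 'a::comm_ring_1"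
  assumes "finite B"
  obtains a where "\<And>\<phi>. (\<Sum>i\<in>B. \<alpha> i * \<phi> (g i)) = (\<Sum>v\<in>g ` B. a v * \<phi> v)"
proof
  fix \<phi>
  have "(\<Sum>i\<in>B. \<alpha> i * \<phi> (g i)) = (\<Sum>v\<in>g ` B. \<Sum>i\<in>{i \<in> B. g i = v}. \<alpha> i * \<phi> (g i))"
    by (rule sum.image_gen[OF assms])
  then show "(\<Sum>i\<in>B. \<alpha> i * \<phi> (g i)) = (\<Sum>v\<in>g ` B. (\<Sum>i\<in>{i \<in> B. g i = v}. \<alpha> i) * \<phi> v)"
    by (simp add: sum_distrib_right)
qed

lemma mat_subspace_compression:
  assumes V: "mat_subspace n V" and P: "P \<in> carrier_mat n n"
  shows "mat_subspace n (compression P V)"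
  unfolding mat_subspace_iff
proof (intro conjI ballI allI)
  have Vc: "V \<subseteq> carrier_mat n n" and V0: "0\<^sub>m n n \<in> V"
    and Vadd: "\<And>A B. A \<in> V \<Longrightarrow> B \<in> V \<Longrightarrow> A + B \<in> V"
    using V by (auto simp: mat_subspace_iff)
  show "compression P V \<subseteq> carrier_mat n n" using P Vc by (auto simp: compression_def)
  have "0\<^sub>m n n = P * 0\<^sub>m n n * P" using P by simp
  then show "0\<^sub>m n n \<in> compression P V" using V0 unfolding compression_def by blast
  fix A B assume "A \<in> compression P V" "B \<in> compression P V"
  then obtain A' B' where A': "A' \<in> V" "A = P * A' * P" and B': "B' \<in> V" "B = P * B' * P"
    by (auto simp: compression_def)
  have "A' \<in> carrier_mat n n" "B' \<in> carrier_mat n n" using A' B' Vc by auto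
  then have "A + B = P * (A' + B') * P"
    using A' B' P by (simp add: mult_add_distrib_mat[of _ n n] add_mult_distrib_mat[of _ n n])
  then show "A + B \<in> compression P V" using Vadd[OF A'(1) B'(1)] by (auto simp: compression_def)
next
  have Vc: "V \<subseteq> carrier_mat n n" and Vsm: "\<And>c A. A \<in> V \<Longrightarrow> c \<cdot>\<^sub>m A \<in> V"
    using V by (auto simp: mat_subspace_iff)
  fix c A assume "A \<in> compression P V"
  then obtain A' where A': "A' \<in> V" "A = P * A' * P" by (auto simp: compression_def)
  have "A' \<in> carrier_mat n n" using A' Vc by auto
  then have "c \<cdot>\<^sub>m A = P * (c \<cdot>\<^sub>m A') * P"
    using A' P by (simp add: mult_smult_distrib[of _ n n] mult_smult_assoc_mat[of _ n n])
  then show "c \<cdot>\<^sub>m A \<in> compression P V" using Vsm[OF A'(1)] by (auto simp: compression_def)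
qed

text \<open>With the frame vectors as columns of \<open>F\<close> and \<open>G\<close> the adjoint
  of \<open>F\<close>, orthonormality reads \<open>G * F = 1\<^sub>m m\<close> and makes
  \<open>P = F * G\<close> a projection. Scalarity reads
  \<open>G * (A * F) = c \<cdot>\<^sub>m 1\<^sub>m m\<close>, and sandwiching it between
  \<open>F\<close> and \<open>G\<close> gives
  \<open>P * A * P = c \<cdot>\<^sub>m P\<close>.\<close>

lemma quantum_anticlique_of_orthonormal_frame:
  fixes f :: "nat \<Rightarrow> nat \<Rightarrow> complex"
  assumes V: "operator_system n V" and m: "0 < m"
    and orthonormal: "\<And>s t. s < m \<Longrightarrow> t < m \<Longrightarrow> sesq n (1\<^sub>m n) (f s) (f t) = of_bool (s = t)"
    and scalar: "\<And>A. A \<in> V \<Longrightarrow> \<exists>c. \<forall>s<m. \<forall>t<m. sesq n A (f s) (f t) = of_bool (s = t) * c"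
  shows "\<exists>P. quantum_anticlique n m V P"
proof -
  interpret vec_space "TYPE(complex)" n .
  have sub: "mat_subspace n V" and V1: "1\<^sub>m n \<in> V" using V by (auto simp: operator_system_def)
  have Vc: "V \<subseteq> carrier_mat n n" using sub by (simp add: mat_subspace_iff)
  define F where "F = mat n m (\<lambda>(i, s). f s i)"
  define G where "G = mat_adjoint F"
  define P where "P = F * G"
  have F: "F \<in> carrier_mat n m" by (simp add: F_def)
  have G: "G \<in> carrier_mat m n" unfolding G_def by (rule mat_adjoint_carrier[OF F])
  have P: "P \<in> carrier_mat n n" using F G by (simp add: P_def)
  have Gi: "G $$ (s, i) = cnj (f s i)" if "s < m" "i < n" for s i
    using that F by (simp add: G_def mat_adjoint_index F_def)
  have GAF: "(G * (A * F)) $$ (s, t) = sesq n A (f s) (f t)"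
    if "A \<in> carrier_mat n n" "s < m" "t < m" for A s t
  proof -
    have "(G * (A * F)) $$ (s, t) = (\<Sum>i<n. G $$ (s, i) * (A * F) $$ (i, t))"
      using that F G by (simp add: scalar_prod_def lessThan_atLeast0)
    also have "\<dots> = (\<Sum>i<n. cnj (f s i) * (\<Sum>j<n. A $$ (i, j) * f t j))"
      using that F G by (intro sum.cong) (auto simp: Gi scalar_prod_def lessThan_atLeast0 F_def)
    finally show ?thesis by (simp add: sesq_def sum_distrib_left mult.assoc)
  qed
  have GF: "G * F = 1\<^sub>m m"
    using GAF[of "1\<^sub>m n"] orthonormal F G by (intro eq_matI) auto
  have PF: "P * F = F" using F G GF by (simp add: P_def assoc_mult_mat[of _ n m _ n _ m])
  have PP: "P * P = P"
    using assoc_mult_mat[of P n n F m G n] P F G PF by (simp add: P_def)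
  have P_adj: "mat_adjoint P = P"
  proof (rule eq_matI)
    fix i j assume "i < dim_row P" "j < dim_col P"
    then have ij: "i < n" "j < n" using P by auto
    have Pij: "P $$ (i, j) = (\<Sum>s<m. f s i * cnj (f s j))" if "i < n" "j < n" for i j
      using that F G by (simp add: P_def scalar_prod_def lessThan_atLeast0 Gi F_def)
    show "mat_adjoint P $$ (i, j) = P $$ (i, j)"
      using mat_adjoint_index[of i P j] ij P by (simp add: Pij mult.commute)
  qed (use P mat_adjoint_carrier[OF P] in auto)
  have PAP: "\<exists>c. P * A * P = c \<cdot>\<^sub>m P" if A: "A \<in> V" for A
  proof -
    obtain c where c: "\<forall>s<m. \<forall>t<m. sesq n A (f s) (f t) = of_bool (s = t) * c" using scalar[OF A] by blast
    have Ac: "A \<in> carrier_mat n n" using A Vc by blast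
    have "G * (A * F) = c \<cdot>\<^sub>m 1\<^sub>m m"
      using GAF[OF Ac] c F G Ac by (intro eq_matI) auto
    have "P * A * P = F * (G * (A * F)) * G"
    proof -
      have "P * A * P = F * (G * (A * (F * G)))"
        using F G Ac by (simp add: P_def assoc_mult_mat[of _ n m _ n _ n] assoc_mult_mat[of _ n n _ n _ n] assoc_mult_mat[of _ m n _ n _ n])
      also have "A * (F * G) = A * F * G" using F G Ac by (simp add: assoc_mult_mat[of _ n n _ m _ n])
      also have "G * (A * F * G) = G * (A * F) * G" using F G Ac by (simp add: assoc_mult_mat[of _ m n _ m _ n])
      also have "F * (G * (A * F) * G) = F * (G * (A * F)) * G"
        using F G Ac by (simp add: assoc_mult_mat[of _ n m _ m _ n])
      finally show ?thesis .
    qed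
    also have "\<dots> = F * (c \<cdot>\<^sub>m 1\<^sub>m m) * G" using \<open>G * (A * F) = c \<cdot>\<^sub>m 1\<^sub>m m\<close> by simp
    also have "F * (c \<cdot>\<^sub>m 1\<^sub>m m) = c \<cdot>\<^sub>m F"
      using mult_smult_distrib[OF F one_carrier_mat] F by simp
    also have "c \<cdot>\<^sub>m F * G = c \<cdot>\<^sub>m P" unfolding P_def by (rule mult_smult_assoc_mat[OF F G])
    finally show ?thesis by blast
  qed
  define S where "S = col F ` {..<m}"
  have S: "finite S" by (simp add: S_def)
  have colF: "col F s = P *\<^sub>v col F s" "col F s \<in> carrier_vec n" if "s < m" for s
    using col_mult2[OF P F that] F that unfolding PF by auto
  have gen: "\<exists>a. \<forall>i<n. (P *\<^sub>v y) $ i = (\<Sum>v\<in>S. a v * v $ i)" if y: "y \<in> carrier_vec n" for y :: "complex vec"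
  proof -
    obtain a where a: "\<And>\<phi>. (\<Sum>s\<in>{..<m}. (G *\<^sub>v y) $ s * \<phi> (col F s)) = (\<Sum>v\<in>S. a v * \<phi> v)"
      using sum_over_image_combination[of "{..<m}" "\<lambda>s. (G *\<^sub>v y) $ s" "col F"] unfolding S_def by blast
    have "(P *\<^sub>v y) $ i = (\<Sum>v\<in>S. a v * v $ i)" if "i < n" for i
    proof -
      have "P *\<^sub>v y = F *\<^sub>v (G *\<^sub>v y)" unfolding P_def by (rule assoc_mult_mat_vec[OF F G y])
      then have "(P *\<^sub>v y) $ i = (\<Sum>s<m. (G *\<^sub>v y) $ s * col F s $ i)"
        using that F G y by (simp add: scalar_prod_def lessThan_atLeast0 mult.commute del: index_mult_mat_vec)
          (simp add: scalar_prod_def lessThan_atLeast0 mult.commute)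
      then show ?thesis using a[of "\<lambda>v. v $ i"] by simp
    qed
    then show ?thesis by blast
  qed
  obtain T where T: "T \<subseteq> S" "card T = rank P"
    "\<And>y. y \<in> carrier_vec n \<Longrightarrow> \<exists>a. \<forall>i<n. (P *\<^sub>v y) $ i = (\<Sum>v\<in>T. a v * v $ i)"
  proof (rule rank_generating_subset[OF P S])
    show "\<exists>y\<in>carrier_vec n. v = P *\<^sub>v y" if "v \<in> S" for v
      using that colF by (auto simp: S_def)
  qed (use gen in blast)+
  have inner: "(\<Sum>i<n. cnj (f s i) * col F t $ i) = of_bool (s = t)" if "s < m" "t < m" for s t
    using orthonormal[OF that] that F by (simp add: sesq_one F_def)
  \<comment> \<open>An omitted column would be a combination of the columns in \<open>T\<close>;
    pairing it with itself through the frame gives 1 on one side and 0 on the other.\<close>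
  have "T = S"
  proof (rule ccontr)
    assume "T \<noteq> S"
    then obtain s where s: "s < m" "col F s \<notin> T" using T(1) by (auto simp: S_def)
    obtain a where a: "\<forall>i<n. col F s $ i = (\<Sum>v\<in>T. a v * v $ i)"
      using T(3)[OF colF(2)[OF s(1)]] colF(1)[OF s(1)] by auto
    have "(1::complex) = (\<Sum>i<n. cnj (f s i) * (\<Sum>v\<in>T. a v * v $ i))"
      using inner[OF s(1) s(1)] a by simp
    also have "\<dots> = (\<Sum>v\<in>T. a v * (\<Sum>i<n. cnj (f s i) * v $ i))"
      unfolding sum_distrib_left by (subst sum.swap) (simp add: mult.left_commute)
    also have "\<dots> = 0"
    proof (rule sum.neutral, rule ballI)
      fix v assume v: "v \<in> T"
      then obtain t where t: "t < m" "v = col F t" using T(1) by (auto simp: S_def)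
      then show "a v * (\<Sum>i<n. cnj (f s i) * v $ i) = 0" using inner[OF s(1) t(1)] s v by auto
    qed
    finally show False by simp
  qed
  have "inj_on (col F) {..<m}"
  proof
    fix s t assume "s \<in> {..<m}" "t \<in> {..<m}" "col F s = col F t"
    then show "s = t" using inner[of s t] inner[of s s] by (auto split: if_splits)
  qed
  then have rank: "rank P = m" using T(2) \<open>T = S\<close> by (simp add: S_def card_image)
  have "P = P * 1\<^sub>m n * P" using P PP by simp
  then have Pc: "P \<in> compression P V" using V1 unfolding compression_def by blast
  have csub: "compression P V \<subseteq> entrywise_span n {P}"
    using PAP P by (fastforce simp: compression_def entrywise_span_def)
  obtain T' where T': "T' \<subseteq> {P}" "card T' = mat_space_dim n (compression P V)"
    "compression P V \<subseteq> entrywise_span n T'"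
    using mat_subspace_generating_subset[OF mat_subspace_compression[OF sub P], of "{P}"] Pc csub by auto
  \<comment> \<open>The compression is not zero: it contains \<open>P\<close>, which fixes the unit
    vector in column 0. This is where \<open>0 < m\<close> enters.\<close>
  have "T' \<noteq> {}"
  proof
    assume "T' = {}"
    then have P0: "P $$ (i, j) = 0" if "i < n" "j < n" for i j
      using T'(3) Pc that by (auto simp: entrywise_span_def)
    have "P *\<^sub>v col F 0 = 0\<^sub>v n"
      using P P0 carrier_matD[OF F] by (intro eq_vecI) (auto simp: scalar_prod_def)
    then have "(\<Sum>i<n. cnj (f 0 i) * col F 0 $ i) = 0" using colF(1)[OF m] by simp
    then show False using inner[OF m m] by simp
  qed
  then have "T' = {P}" using T' by auto
  then have "mat_space_dim n (compression P V) = 1" using T'(2) by simp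
  then show ?thesis
    unfolding quantum_anticlique_def orthogonal_projection_def using P PP P_adj rank by blast
qed

text \<open>Orthogonality removes all cross terms between the \<open>e s\<close>, so a superposition
  over part \<open>j\<close> has the diagonal value given by the weighted sum over that part, and
  Tverberg's theorem makes it independent of \<open>j\<close>. Equality on a basis extends to all of
  the operator system by linearity.\<close>

lemma exists_quantum_anticlique:
  assumes V: "operator_system n V" and large: "k * (mat_space_dim n V)\<^sup>2 \<le> n" and k: "k < n"
  shows "\<exists>P. quantum_anticlique n (k + 1) V P"
proof -
  obtain S where S: "finite S" "S \<subseteq> V" "card S = mat_space_dim n V"
    "\<And>b. b \<in> S \<Longrightarrow> mat_adjoint b = b" "V \<subseteq> entrywise_span n S"
    using operator_system_hermitian_basis[OF V] by blast
  have Vc: "V \<subseteq> carrier_mat n n" and V1: "1\<^sub>m n \<in> V"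
    using V by (auto simp: operator_system_def mat_subspace_iff)
  define N where "N = k * card S"
  have Sc: "S \<subseteq> carrier_mat n n" using S Vc by blast
  have one: "1\<^sub>m n \<in> entrywise_span n S" using V1 S by blast
  obtain e where e: "\<And>s. s \<le> N \<Longrightarrow> \<exists>i<n. e s i \<noteq> 0"
    "\<And>s t b. s \<le> N \<Longrightarrow> t \<le> N \<Longrightarrow> s \<noteq> t \<Longrightarrow> b \<in> S \<Longrightarrow> sesq n b (e s) (e t) = 0"
    using exists_orthogonal_frame[OF S(1) Sc S(4) one _ k] large S(3) unfolding N_def by auto
  \<comment> \<open>Hermitian basis elements have real diagonal values, so Tverberg's theorem is
    needed in \<open>card S\<close> real dimensions rather than twice as many.\<close>
  have real: "sesq n b (e s) (e s) = of_real (Re (sesq n b (e s) (e s)))" if "b \<in> S" for b s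
  proof -
    have "sesq n b (e s) (e s) = cnj (sesq n b (e s) (e s))"
      using sesq_hermitian that Sc S(4) by blast
    then show ?thesis by (simp add: complex_eq_iff)
  qed
  obtain \<sigma> :: "nat \<Rightarrow> nat" and w :: "nat \<Rightarrow> real" and y :: "complex mat \<Rightarrow> real"
    where w: "\<And>i. 0 \<le> w i" "\<exists>i\<le>N. 0 < w i" and \<sigma>: "\<And>i. i \<le> N \<Longrightarrow> \<sigma> i \<le> k"
    and y: "\<And>j b. j \<le> k \<Longrightarrow> b \<in> S \<Longrightarrow>
      (\<Sum>i\<le>N. of_bool (\<sigma> i = j) * Re (sesq n b (e i) (e i)) * w i) = y b"
    unfolding N_def
    by (rule conical_Tverberg[OF S(1), where x = "\<lambda>i b. Re (sesq n b (e i) (e i))" and k = k]) blast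
  \<comment> \<open>Square roots, because the form is quadratic in the coefficients and should
    produce the weights themselves.\<close>
  define g where "g j i = (\<Sum>s\<le>N. of_bool (\<sigma> s = j) * of_real (sqrt (w s)) * e s i)" for j i
  have sesq_g: "sesq n A (g j) (g l) = (\<Sum>s\<le>N. \<Sum>t\<le>N.
      of_bool (\<sigma> s = j) * of_bool (\<sigma> t = l) * of_real (sqrt (w s) * sqrt (w t)) * sesq n A (e s) (e t))" for A j l
    unfolding g_def sesq_sum_left sesq_sum_right sum_distrib_left
    by (intro sum.cong refl) (simp add: of_bool_def)
  have sqrt_w: "complex_of_real (sqrt (w s)) * complex_of_real (sqrt (w s)) = of_real (w s)" for s
    using w(1)[of s] by (simp only: of_real_mult[symmetric]) simp
  have sesq_S: "sesq n b (g j) (g l) = of_bool (j = l) * of_real (y b)" if "b \<in> S" "j \<le> k" "l \<le> k" for b j l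
  proof -
    have "sesq n b (g j) (g l) = (\<Sum>s\<le>N. \<Sum>t\<le>N. if t = s then
      of_bool (\<sigma> s = j) * of_bool (\<sigma> s = l) * of_real (w s) * sesq n b (e s) (e s) else 0)"
      unfolding sesq_g using e(2) that sqrt_w by (intro sum.cong refl) auto
    also have "\<dots> = (\<Sum>s\<le>N. of_bool (\<sigma> s = j) * of_bool (\<sigma> s = l) * of_real (w s) * sesq n b (e s) (e s))"
      by simp
    also have "\<dots> = (\<Sum>s\<le>N. of_bool (j = l) * of_real (of_bool (\<sigma> s = j) * Re (sesq n b (e s) (e s)) * w s))"
      using real[OF that(1)] by (intro sum.cong refl) (auto simp: mult.commute)
    also have "\<dots> = of_bool (j = l) * of_real (\<Sum>s\<le>N. of_bool (\<sigma> s = j) * Re (sesq n b (e s) (e s)) * w s)"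
      by (simp only: sum_distrib_left of_real_sum)
    also have "\<dots> = of_bool (j = l) * of_real (y b)" by (simp only: y[OF that(2,1)])
    finally show ?thesis .
  qed
  have scalar: "\<exists>c. \<forall>j\<le>k. \<forall>l\<le>k. sesq n A (g j) (g l) = of_bool (j = l) * c" if "A \<in> V" for A
  proof -
    have "A \<in> entrywise_span n S" using that S(5) by blast
    then obtain a where "\<And>i j. i < n \<Longrightarrow> j < n \<Longrightarrow> A $$ (i, j) = (\<Sum>b\<in>S. a b * b $$ (i, j))"
      by (auto simp: entrywise_span_def)
    from sesq_combination[OF this]
    have "sesq n A (g j) (g l) = of_bool (j = l) * (\<Sum>b\<in>S. a b * of_real (y b))" if "j \<le> k" "l \<le> k" for j l
      using that by (simp add: sesq_S)
    then show ?thesis by blast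
  qed
  obtain c where c: "\<And>j l. j \<le> k \<Longrightarrow> l \<le> k \<Longrightarrow> sesq n (1\<^sub>m n) (g j) (g l) = of_bool (j = l) * c"
    using scalar[OF V1] by blast
  have norm_e: "sesq n (1\<^sub>m n) x x = of_real (\<Sum>i<n. (cmod (x i))\<^sup>2)" for x
    unfolding sesq_one by (simp add: complex_norm_square[symmetric] mult.commute del: of_real_power)
  have e1: "sesq n (1\<^sub>m n) (e s) (e t) = 0" if "s \<le> N" "t \<le> N" "s \<noteq> t" for s t
  proof -
    obtain a where "\<And>i j. i < n \<Longrightarrow> j < n \<Longrightarrow> (1\<^sub>m n) $$ (i, j) = (\<Sum>b\<in>S. a b * b $$ (i, j))"
      using one by (auto simp: entrywise_span_def)
    from sesq_combination[OF this] show ?thesis using e(2)[OF that] by simp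
  qed
  \<comment> \<open>The scalar \<open>c\<close> of the identity is the common squared norm of all
    \<open>g j\<close>. One positive weight makes it positive in the part of \<open>s0\<close>,
    hence no part yields the zero vector.\<close>
  obtain s0 where s0: "s0 \<le> N" "0 < w s0" using w by blast
  have "c = sesq n (1\<^sub>m n) (g (\<sigma> s0)) (g (\<sigma> s0))" using c \<sigma>[OF s0(1)] by simp
  also have "\<dots> = (\<Sum>s\<le>N. \<Sum>t\<le>N. if t = s then
      of_bool (\<sigma> s = \<sigma> s0) * of_real (w s) * sesq n (1\<^sub>m n) (e s) (e s) else 0)"
    unfolding sesq_g using e1 sqrt_w by (intro sum.cong refl) auto
  also have "\<dots> = of_real (\<Sum>s\<le>N. of_bool (\<sigma> s = \<sigma> s0) * w s * (\<Sum>i<n. (cmod (e s i))\<^sup>2))"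
    unfolding of_real_sum by (simp add: norm_e, intro sum.cong) auto
  finally have c_real: "c = of_real (\<Sum>s\<le>N. of_bool (\<sigma> s = \<sigma> s0) * w s * (\<Sum>i<n. (cmod (e s i))\<^sup>2))"
    (is "c = of_real ?r") .
  have "0 < ?r"
  proof (rule sum_pos2[of _ s0])
    obtain i where "i < n" "e s0 i \<noteq> 0" using e(1)[OF s0(1)] by blast
    then have "0 < (\<Sum>i<n. (cmod (e s0 i))\<^sup>2)" by (intro sum_pos2[of _ i]) auto
    then show "0 < of_bool (\<sigma> s0 = \<sigma> s0) * w s0 * (\<Sum>i<n. (cmod (e s0 i))\<^sup>2)" using s0 by simp
  qed (use s0 w(1) in \<open>auto intro!: mult_nonneg_nonneg sum_nonneg\<close>)
  then obtain r where r: "0 < r" "c = of_real r" using c_real by blast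
  define f where "f j i = of_real (1 / sqrt r) * g j i" for j i
  have sesq_f: "sesq n A (f j) (f l) = of_real (1 / r) * sesq n A (g j) (g l)" for A j l
  proof -
    have "of_real (1 / sqrt r) * of_real (1 / sqrt r) = (of_real (1 / r) :: complex)"
      using r by (simp only: of_real_mult[symmetric]) simp
    moreover have "sesq n A (f j) (f l)
        = of_real (1 / sqrt r) * of_real (1 / sqrt r) * sesq n A (g j) (g l)"
      unfolding sesq_def f_def sum_distrib_left
      by (intro sum.cong refl) (simp only: complex_cnj_mult complex_cnj_complex_of_real mult_ac)
    ultimately show ?thesis by simp
  qed
  show ?thesis
  proof (rule quantum_anticlique_of_orthonormal_frame[OF V, of _ f])
    fix s t assume "s < k + 1" "t < k + 1"
    then show "sesq n (1\<^sub>m n) (f s) (f t) = of_bool (s = t)" using c[of s t] r by (simp add: sesq_f)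
  next
    fix A assume "A \<in> V"
    then obtain c' where "\<forall>j\<le>k. \<forall>l\<le>k. sesq n A (g j) (g l) = of_bool (j = l) * c'" using scalar by blast
    then show "\<exists>c. \<forall>s<k + 1. \<forall>t<k + 1. sesq n A (f s) (f t) = of_bool (s = t) * c"
      by (intro exI[of _ "of_real (1 / r) * c'"]) (auto simp: sesq_f)
  qed simp
qed

section \<open>The operator system for the upper bound\<close>

definition block_diagonal :: "nat \<Rightarrow> nat \<Rightarrow> (nat \<Rightarrow> complex) \<Rightarrow> complex mat" where
  "block_diagonal n k c = mat n n (\<lambda>(i, j). if i = j then c (i div k) else 0)"

lemma operator_system_block_diagonal: "operator_system n (range (block_diagonal n k))"
  unfolding operator_system_def mat_subspace_iff
proof (intro conjI ballI allI)
  show "range (block_diagonal n k) \<subseteq> carrier_mat n n" by (auto simp: block_diagonal_def)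
  show "0\<^sub>m n n \<in> range (block_diagonal n k)"
    by (rule range_eqI[of _ _ "\<lambda>_. 0"]) (auto simp: block_diagonal_def)
  show "1\<^sub>m n \<in> range (block_diagonal n k)"
    by (rule range_eqI[of _ _ "\<lambda>_. 1"]) (auto simp: block_diagonal_def)
  fix A assume "A \<in> range (block_diagonal n k)"
  then obtain a where a: "A = block_diagonal n k a" by blast
  show "mat_adjoint A \<in> range (block_diagonal n k)"
  proof (rule range_eqI[of _ _ "\<lambda>i. cnj (a i)"], rule eq_matI)
    fix i j assume "i < dim_row (block_diagonal n k (\<lambda>i. cnj (a i)))"
      "j < dim_col (block_diagonal n k (\<lambda>i. cnj (a i)))"
    then have "i < n" "j < n" by (auto simp: block_diagonal_def)
    then show "mat_adjoint A $$ (i, j) = block_diagonal n k (\<lambda>i. cnj (a i)) $$ (i, j)"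
      using mat_adjoint_index[of i A j] by (auto simp: a block_diagonal_def)
  qed (auto simp: a block_diagonal_def mat_adjoint_def)
  show "c \<cdot>\<^sub>m A \<in> range (block_diagonal n k)" for c
    by (rule range_eqI[of _ _ "\<lambda>i. c * a i"]) (auto simp: a block_diagonal_def)
  fix B assume "B \<in> range (block_diagonal n k)"
  then obtain b where b: "B = block_diagonal n k b" by blast
  show "A + B \<in> range (block_diagonal n k)"
    by (rule range_eqI[of _ _ "\<lambda>i. a i + b i"]) (auto simp: a b block_diagonal_def)
qed

text \<open>The matrices are scalar on each block, so the coordinate projections \<open>E b\<close>
  onto the blocks generate the system. A bound suffices for the theorem, and independence of the
  \<open>E b\<close> is not claimed: those with no index in their block vanish.\<close>

lemma mat_space_dim_block_diagonal:
  assumes "\<And>i. i < n \<Longrightarrow> i div k < q"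
  shows "mat_space_dim n (range (block_diagonal n k)) \<le> q"
proof -
  define E where "E b = block_diagonal n k (\<lambda>i. of_bool (i = b))" for b
  have sub: "mat_subspace n (range (block_diagonal n k))"
    using operator_system_block_diagonal by (simp add: operator_system_def)
  have "range (block_diagonal n k) \<subseteq> entrywise_span n (E ` {..<q})"
  proof
    fix A assume "A \<in> range (block_diagonal n k)"
    then obtain c where c: "A = block_diagonal n k c" by blast
    obtain a where a: "\<And>\<phi>. (\<Sum>b\<in>{..<q}. c b * \<phi> (E b)) = (\<Sum>v\<in>E ` {..<q}. a v * \<phi> v)"
      using sum_over_image_combination[of "{..<q}" c E] by blast
    have "A $$ (i, j) = (\<Sum>v\<in>E ` {..<q}. a v * v $$ (i, j))" if ij: "i < n" "j < n" for i j
    proof -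
      have "(\<Sum>b\<in>{..<q}. c b * E b $$ (i, j)) = (\<Sum>b\<in>{..<q}. if b = i div k then A $$ (i, j) else 0)"
        using ij by (intro sum.cong) (auto simp: E_def c block_diagonal_def)
      also have "\<dots> = A $$ (i, j)" using assms ij by simp
      finally show ?thesis using a[of "\<lambda>v. v $$ (i, j)"] by simp
    qed
    moreover have "A \<in> carrier_mat n n" by (simp add: c block_diagonal_def)
    ultimately show "A \<in> entrywise_span n (E ` {..<q})" by (auto simp: entrywise_span_def)
  qed
  moreover have "finite (E ` {..<q})" "E ` {..<q} \<subseteq> range (block_diagonal n k)" by (auto simp: E_def)
  ultimately obtain T where T: "T \<subseteq> E ` {..<q}" "card T = mat_space_dim n (range (block_diagonal n k))"
    using mat_subspace_generating_subset[OF sub] by metis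
  have "card T \<le> card (E ` {..<q})" by (intro card_mono T) auto
  also have "\<dots> \<le> q" using card_image_le[of "{..<q}" E] by simp
  finally show ?thesis using T by simp
qed

text \<open>The compression is one-dimensional and contains \<open>P\<close>, the compression of the
  identity. As \<open>P\<close> has positive rank it is nonzero and spans the compression.\<close>

lemma compression_anticlique_scalar:
  assumes V: "operator_system n V" and P: "quantum_anticlique n m V P" and m: "0 < m" and A: "A \<in> V"
  obtains c where "P * A * P = c \<cdot>\<^sub>m P"
proof -
  have Pc: "P \<in> carrier_mat n n" and PP: "P * P = P" and rank: "vec_space.rank n P = m"
    and dim: "mat_space_dim n (compression P V) = 1"
    using P by (auto simp: quantum_anticlique_def orthogonal_projection_def)
  have sub: "mat_subspace n V" and V1: "1\<^sub>m n \<in> V" using V by (auto simp: operator_system_def)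
  have csub: "mat_subspace n (compression P V)" by (rule mat_subspace_compression[OF sub Pc])
  obtain S where S: "finite S" "S \<subseteq> compression P V" "compression P V \<subseteq> entrywise_span n S"
    using mat_subspace_finite_generating_set[OF csub] .
  obtain T where T: "T \<subseteq> S" "card T = 1" "compression P V \<subseteq> entrywise_span n T"
    using mat_subspace_generating_subset[OF csub S] dim by metis
  obtain B where B: "T = {B}" using T(2) by (auto simp: card_1_singleton_iff)
  have "P = P * 1\<^sub>m n * P" using Pc PP by simp
  then have "P \<in> compression P V" using V1 unfolding compression_def by blast
  then have "P \<in> entrywise_span n {B}" using T(3) B by blast
  then obtain p where p: "\<forall>i<n. \<forall>j<n. P $$ (i, j) = p * B $$ (i, j)"
    by (auto simp: entrywise_span_def)
  have PAP: "P * A * P \<in> compression P V" using A unfolding compression_def by blast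
  then have "P * A * P \<in> entrywise_span n {B}" using T(3) B by blast
  then obtain a where a: "\<forall>i<n. \<forall>j<n. (P * A * P) $$ (i, j) = a * B $$ (i, j)"
    and PAPc: "P * A * P \<in> carrier_mat n n"
    by (auto simp: entrywise_span_def simp del: index_mult_mat)
  have "p \<noteq> 0"
  proof
    assume "p = 0"
    interpret vec_space "TYPE(complex)" n .
    have "P = 0\<^sub>m n n" using p \<open>p = 0\<close> Pc by (intro eq_matI) auto
    then have "rank P = 0" using rank_0I by simp
    then show False using rank m by simp
  qed
  then have "P * A * P = (a / p) \<cdot>\<^sub>m P" using a p Pc PAPc by (intro eq_matI) auto
  then show thesis by (rule that)
qed

lemma no_quantum_anticlique_block_diagonal:
  assumes k: "0 < k"
  shows "\<nexists>P. quantum_anticlique n (k + 1) (range (block_diagonal n k)) P"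
proof
  assume "\<exists>P. quantum_anticlique n (k + 1) (range (block_diagonal n k)) P"
  then obtain P where P: "quantum_anticlique n (k + 1) (range (block_diagonal n k)) P" by blast
  interpret vec_space "TYPE(complex)" n .
  have Pc: "P \<in> carrier_mat n n" and PP: "P * P = P" and rank: "rank P = k + 1"
    using P by (auto simp: quantum_anticlique_def orthogonal_projection_def)
  define E where "E b = block_diagonal n k (\<lambda>i. of_bool (i = b))" for b
  define I where "I b = {l. l < n \<and> l div k = b}" for b
  have I: "finite (I b)" for b by (simp add: I_def)
  have card_I: "card (I b) \<le> k" for b
  proof -
    have "I b \<subseteq> {b * k..<b * k + k}"
      using k dividend_less_div_times[of k] by (auto simp: I_def add.commute)
    then have "card (I b) \<le> card {b * k..<b * k + k}" by (intro card_mono) auto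
    then show ?thesis by simp
  qed
  have Ec: "E b \<in> carrier_mat n n" for b by (simp add: E_def block_diagonal_def)
  have PEP: "(P * E b * P) $$ (i, j) = (\<Sum>l\<in>I b. P $$ (i, l) * P $$ (l, j))"
    if ij: "i < n" "j < n" for b i j
  proof -
    have "(P * E b) $$ (i, l) = of_bool (l div k = b) * P $$ (i, l)" if "l < n" for l
    proof -
      have "(P * E b) $$ (i, l) = (\<Sum>h<n. P $$ (i, h) * E b $$ (h, l))"
        by (rule mat_mult_index_sum[OF Pc Ec ij(1) that])
      also have "\<dots> = (\<Sum>h<n. if h = l then of_bool (l div k = b) * P $$ (i, l) else 0)"
        using that by (intro sum.cong) (auto simp: E_def block_diagonal_def)
      finally show ?thesis using that by simp
    qed
    then have "(P * E b * P) $$ (i, j) = (\<Sum>l<n. of_bool (l div k = b) * P $$ (i, l) * P $$ (l, j))"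
      using mat_mult_index_sum[OF mult_carrier_mat[OF Pc Ec[of b]] Pc ij] by simp
    also have "\<dots> = (\<Sum>l\<in>I b. P $$ (i, l) * P $$ (l, j))"
      by (rule sum.mono_neutral_cong_right) (auto simp: I_def)
    finally show ?thesis .
  qed
  have PEP0: "P * E b * P = 0\<^sub>m n n" for b
  proof -
    have "E b \<in> range (block_diagonal n k)" by (simp add: E_def)
    then obtain c where c: "P * E b * P = c \<cdot>\<^sub>m P"
      using compression_anticlique_scalar[OF operator_system_block_diagonal P] by auto
    \<comment> \<open>Otherwise \<open>c * P\<close> is a sum of products of a column and a row of
      \<open>P\<close> over the indices of block \<open>b\<close>. The columns in that block then
      span the image of \<open>P\<close>, and there are at most \<open>k\<close> of them.\<close>
    have "c = 0"
    proof (rule ccontr)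
      assume c0: "c \<noteq> 0"
      have cP: "c * P $$ (i, j) = (\<Sum>l\<in>I b. P $$ (i, l) * P $$ (l, j))" if "i < n" "j < n" for i j
        using PEP[OF that, of b] that Pc by (simp add: c)
      define G where "G = col P ` I b"
      obtain T where T: "T \<subseteq> G" "card T = rank P"
      proof (rule rank_generating_subset[OF Pc])
        show "finite G" by (simp add: G_def I)
        show "\<exists>y\<in>carrier_vec n. v = P *\<^sub>v y" if "v \<in> G" for v
        proof -
          obtain l where "l < n" "v = col P l" using \<open>v \<in> G\<close> by (auto simp: G_def I_def)
          then show ?thesis using col_mult2[OF Pc Pc, of l] Pc PP by (intro bexI[of _ "col P l"]) auto
        qed
        show "\<exists>a. \<forall>i<n. (P *\<^sub>v y) $ i = (\<Sum>v\<in>G. a v * v $ i)" if y: "y \<in> carrier_vec n" for y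
        proof -
          obtain a where a: "\<And>\<phi>. (\<Sum>l\<in>I b. ((P *\<^sub>v y) $ l / c) * \<phi> (col P l)) = (\<Sum>v\<in>G. a v * \<phi> v)"
            using sum_over_image_combination[OF I[of b], of "\<lambda>l. (P *\<^sub>v y) $ l / c" "col P"]
            unfolding G_def by blast
          have Py: "(P *\<^sub>v y) $ i = (\<Sum>j<n. P $$ (i, j) * y $ j)" if "i < n" for i
            using Pc y that by (simp add: scalar_prod_def lessThan_atLeast0)
          have "(P *\<^sub>v y) $ i = (\<Sum>v\<in>G. a v * v $ i)" if i: "i < n" for i
          proof -
            have "c * (P *\<^sub>v y) $ i = (\<Sum>j<n. (\<Sum>l\<in>I b. P $$ (i, l) * P $$ (l, j)) * y $ j)"
              unfolding Py[OF i] sum_distrib_left using cP i by (intro sum.cong) (auto simp: mult.assoc[symmetric])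
            also have "\<dots> = (\<Sum>l\<in>I b. P $$ (i, l) * (\<Sum>j<n. P $$ (l, j) * y $ j))"
              unfolding sum_distrib_left sum_distrib_right by (subst sum.swap) (simp add: mult.assoc)
            also have "\<dots> = (\<Sum>l\<in>I b. (P *\<^sub>v y) $ l * col P l $ i)"
              using i Pc by (intro sum.cong) (auto simp: I_def Py[symmetric] simp del: index_mult_mat_vec)
            finally have "(P *\<^sub>v y) $ i = (\<Sum>l\<in>I b. (P *\<^sub>v y) $ l * col P l $ i) / c"
              using c0 by (simp add: field_simps)
            then show ?thesis using a[of "\<lambda>v. v $ i"] by (simp add: sum_divide_distrib)
          qed
          then show ?thesis by blast
        qed
      qed blast
      have "rank P \<le> card G" using T card_mono[of G T] by (simp add: G_def I)
      also have "\<dots> \<le> k" unfolding G_def using card_image_le[OF I] card_I order_trans by blast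
      finally show False using rank by simp
    qed
    then show ?thesis using c Pc by (intro eq_matI) auto
  qed
  have "P = 0\<^sub>m n n"
  proof (rule eq_matI)
    fix i j assume "i < dim_row (0\<^sub>m n n :: complex mat)" "j < dim_col (0\<^sub>m n n :: complex mat)"
    then have ij: "i < n" "j < n" by auto
    have "P $$ (i, j) = (P * P) $$ (i, j)" by (simp add: PP)
    also have "\<dots> = (\<Sum>l<n. P $$ (i, l) * P $$ (l, j))"
      by (rule mat_mult_index_sum[OF Pc Pc ij])
    \<comment> \<open>Grouping the inner index by blocks expresses \<open>P * P\<close> as the sum
      of the vanishing \<open>P * E b * P\<close>.\<close>
    also have "\<dots> = (\<Sum>b\<in>(\<lambda>l. l div k) ` {..<n}. \<Sum>l\<in>{l \<in> {..<n}. l div k = b}. P $$ (i, l) * P $$ (l, j))"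
      by (rule sum.image_gen) simp
    also have "\<dots> = (\<Sum>b\<in>(\<lambda>l. l div k) ` {..<n}. (P * E b * P) $$ (i, j))"
      using ij by (intro sum.cong refl) (simp add: PEP I_def)
    also have "\<dots> = 0" using ij by (simp add: PEP0)
    finally show "P $$ (i, j) = 0\<^sub>m n n $$ (i, j)" using ij by simp
  qed (use Pc in auto)
  then show False using rank rank_0I[of n] by simp
qed

section \<open>Combination of the two bounds\<close>

lemma operator_system_dim_pos:
  assumes V: "operator_system n V" and n: "0 < n"
  shows "0 < mat_space_dim n V"
proof (rule ccontr)
  assume no: "\<not> ?thesis"
  obtain S where S: "finite S" "card S = mat_space_dim n V" "V \<subseteq> entrywise_span n S"
    using operator_system_hermitian_basis[OF V] by metis
  then have "S = {}" using no by simp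
  then have "1\<^sub>m n \<in> entrywise_span n {}" using V S by (auto simp: operator_system_def)
  then have "(1\<^sub>m n :: complex mat) $$ (0, 0) = 0" using n by (simp add: entrywise_span_def del: index_one_mat)
  then show False using n by simp
qed

text \<open>The case \<open>n = k\<close> is excluded from the strict inequality because both of its
  sides are then 1: the upper bound gives at most 1, and an operator system has positive
  dimension.\<close>

theorem theorem2p11:
  fixes n k :: nat
  assumes "n \<ge> 1" and "k \<ge> 1"
  shows "(n \<noteq> k \<longrightarrow> sqrt (real n / real k) < real (lower_quantum_turan n k)) \<and>
         int (lower_quantum_turan n k) \<le> \<lceil>real n / real k\<rceil>"
proof
  define D where "D d \<longleftrightarrow> (\<exists>V. operator_system n V \<and> mat_space_dim n V = d \<and>
    (\<nexists>P. quantum_anticlique n (k + 1) V P))" for d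
  have T: "lower_quantum_turan n k = (LEAST d. D d)" by (simp add: lower_quantum_turan_def D_def)
  let ?q = "nat \<lceil>real n / real k\<rceil>"
  have "i div k < ?q" if "i < n" for i
  proof -
    have "real (i div k) \<le> real i / real k" by (rule of_nat_div_le_of_nat)
    also have "\<dots> < real n / real k" using that assms by (simp add: divide_strict_right_mono)
    finally show ?thesis by linarith
  qed
  then have le: "mat_space_dim n (range (block_diagonal n k)) \<le> ?q" by (rule mat_space_dim_block_diagonal)
  \<comment> \<open>Besides the upper bound, this witness ensures that the least dimension is
    attained, as the lower bound requires.\<close>
  have D: "D (mat_space_dim n (range (block_diagonal n k)))"
    unfolding D_def
    by (intro exI[of _ "range (block_diagonal n k)"] conjI refl operator_system_block_diagonal
        no_quantum_anticlique_block_diagonal) (use assms in simp)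
  have "lower_quantum_turan n k \<le> ?q" unfolding T using Least_le[of D, OF D] le by linarith
  moreover have "0 \<le> real n / real k" by simp
  then have "0 \<le> \<lceil>real n / real k\<rceil>" by linarith
  ultimately show "int (lower_quantum_turan n k) \<le> \<lceil>real n / real k\<rceil>" by linarith
  show "n \<noteq> k \<longrightarrow> sqrt (real n / real k) < real (lower_quantum_turan n k)"
  proof
    assume nk: "n \<noteq> k"
    have "D (lower_quantum_turan n k)" unfolding T using D by (rule LeastI)
    then obtain V where V: "operator_system n V" "mat_space_dim n V = lower_quantum_turan n k"
      and no: "\<nexists>P. quantum_anticlique n (k + 1) V P" unfolding D_def by blast
    let ?d = "lower_quantum_turan n k"
    have d: "?d \<noteq> 0" using operator_system_dim_pos[OF V(1)] V(2) assms by simp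
    show "sqrt (real n / real k) < real ?d"
    proof (rule ccontr)
      assume "\<not> ?thesis"
      then have "real ?d \<le> sqrt (real n / real k)" by simp
      then have "(real ?d)\<^sup>2 \<le> (sqrt (real n / real k))\<^sup>2" by (intro power_mono) auto
      then have "(real ?d)\<^sup>2 \<le> real n / real k" by simp
      then have "real (k * ?d\<^sup>2) \<le> real n" using assms by (simp add: field_simps)
      then have large: "k * ?d\<^sup>2 \<le> n" by (simp only: of_nat_le_iff)
      \<comment> \<open>A positive dimension turns \<open>k * ?d\<^sup>2 \<le> n\<close> into
        \<open>k \<le> n\<close>, and \<open>n \<noteq> k\<close> makes this strict.\<close>
      have "1 \<le> ?d\<^sup>2" using d by simp
      then have "k * 1 \<le> k * ?d\<^sup>2" by (rule mult_le_mono2)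
      with large nk have "k < n" by linarith
      then show False using exists_quantum_anticlique[OF V(1)] V(2) large no by auto
    qed
  qed
qed

end
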